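(* Let $u,v\in W$ with $u\leqslant v$. Then $$m_{u,v}=\sum_{u\leqslant x\leqslant v}\overline{r_{x,v}}$$ and $$r_{u,v}=\sum_{u\leqslant x\leqslant v}\varepsilon_u\,\varepsilon_x\,\overline{m_{x,v}}.$$
   Context: Let $\hat T(\mathbb{C})$ be a maximal torus in a complex reductive group, $\Phi$ the root system in the character lattice $X^*(\hat T)$, $\Phi^+$ a choice of positive roots, and $W$ the Weyl group with its simple reflections $s=s_\alpha$ ($\alpha$ simple), length function $l$ and Bruhat order $\leqslant$. For $\mathbf{z}\in\hat T(\mathbb{C})$ and $\lambda\in X^*(\hat T)$, $\mathbf{z}^\lambda$ is the value of $\lambda$ at $\mathbf{z}$; $W$ acts on $\hat T(\mathbb{C})$ by $(w\mathbf{z})^\lambda=\mathbf{z}^{w^{-1}\lambda}$. Let $q$ be an indeterminate, $q_w=q^{l(w)}$ and $\varepsilon_w=(-1)^{l(w)}$. For a rational function $f$ of $q$ and $\mathbf{z}$, $\overline f$ is the result of replacing $q$ by $q^{-1}$, leaving $\mathbf{z}$ unchanged. Let $\mathcal{H}$ be the Iwahori Hecke algebra of $W$, with scalars extended to the field of rational functions in $q$ and $\mathbf{z}$, with basis $T_w$ ($w\in W$), where $T_wT_{w'}=T_{ww'}$ if $l(ww')=l(w)+l(w')$ and $T_s^2=(q-1)T_s+q$ for simple reflections $s$. For a simple reflection $s=s_\alpha$ put $$\mu_{\mathbf{z}}(s)=q^{-1}T_s+(1-q^{-1})\frac{\mathbf{z}^\alpha}{1-\mathbf{z}^\alpha}.$$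 This extends uniquely (a known fact) to elements $\mu_{\mathbf{z}}(w)$, $w\in W$, with $\mu_{\mathbf{z}}(1)=1$ and $\mu_{\mathbf{z}}(w_1w_2)=\mu_{\mathbf{z}}(w_2)\,\mu_{w_2\mathbf{z}}(w_1)$ whenever $l(w_1w_2)=l(w_1)+l(w_2)$. The functions $r_{u,v}=r_{u,v}(\mathbf{z})$ (zero unless $u\leqslant v$) are defined by $$\mu_{\mathbf{z}}(v)=\sum_{u\leqslant v}q_u^{-1}\,\overline{r_{u,v}}\,T_{u^{-1}}.$$ Let $\Lambda$ be the linear functional on $\mathcal{H}$ with $\Lambda(T_1)=1$ and $\Lambda(T_w)=0$ for $w\neq1$, let $\psi_u=\sum_{x\geqslant u}T_x$, and define $m_{u,v}=m_{u,v}(\mathbf{z})=\Lambda(\psi_u\,\mu_{\mathbf{z}}(v))$. *)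

theory Defs
  imports
    Complex_Main
    "HOL-Library.Poly_Mapping"
    "HOL-Computational_Algebra.Polynomial"
    "HOL-Computational_Algebra.Fraction_Field"
begin

section \<open>Root data and Weyl groups\<close>

definition zmult :: "int \<Rightarrow> 'x::ab_group_add \<Rightarrow> 'x" where
  "zmult k x = (if 0 \<le> k then ((+) x ^^ nat k) 0 else - ((+) x ^^ nat (- k)) 0)"

text \<open>
  A complex reductive group with a maximal torus is encoded by its reduced root datum. The
  character lattice is the whole type \<open>'x\<close>; \<open>coroot R \<alpha> \<nu>\<close> is the pairing of \<open>\<nu>\<close> with the coroot of
  \<open>\<alpha>\<close>. The class \<open>linordered_ab_group_add\<close> loses no generality: a finitely generated abelian group
  is free iff it carries a translation invariant linear order. That order is unrelated to the
  choice of positive roots; it only serves to make the group algebra an instance of \<open>idom\<close>.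
\<close>

record 'x root_datum =
  roots :: "'x set"
  coroot :: "'x \<Rightarrow> 'x \<Rightarrow> int"
  pos :: "'x set"

definition reflection :: "('x::ab_group_add, 'm) root_datum_scheme \<Rightarrow> 'x \<Rightarrow> 'x \<Rightarrow> 'x" where
  "reflection R \<alpha> \<nu> = \<nu> - zmult (coroot R \<alpha> \<nu>) \<alpha>"

locale based_root_datum =
  fixes R :: "('x::linordered_ab_group_add, 'm) root_datum_scheme"
  assumes lattice_fg:
      "\<exists>B. finite B \<and> (\<forall>S. B \<subseteq> S \<and> 0 \<in> S \<and> (\<forall>x\<in>S. \<forall>y\<in>S. x - y \<in> S) \<longrightarrow> S = (UNIV :: 'x set))"
    and finite_roots: "finite (roots R)"
    and coroot_additive:
      "\<alpha> \<in> roots R \<Longrightarrow> coroot R \<alpha> (\<nu> + \<nu>') = coroot R \<alpha> \<nu> + coroot R \<alpha> \<nu>'"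
    and coroot_inj: "inj_on (coroot R) (roots R)"
    and coroot_self: "\<alpha> \<in> roots R \<Longrightarrow> coroot R \<alpha> \<alpha> = 2"
    and refl_roots: "\<alpha> \<in> roots R \<Longrightarrow> reflection R \<alpha> ` roots R = roots R"
    and refl_coroots: "\<alpha> \<in> roots R \<Longrightarrow>
      (\<lambda>y \<nu>. y \<nu> - y \<alpha> * coroot R \<alpha> \<nu>) ` coroot R ` roots R = coroot R ` roots R"
    and reduced: "\<alpha> \<in> roots R \<Longrightarrow> \<alpha> + \<alpha> \<notin> roots R"
    and pos_half_space: "\<exists>h :: 'x \<Rightarrow> real. (\<forall>\<nu> \<nu>'. h (\<nu> + \<nu>') = h \<nu> + h \<nu>') \<and>
      (\<forall>\<alpha>\<in>roots R. h \<alpha> \<noteq> 0) \<and> pos R = {\<alpha> \<in> roots R. h \<alpha> > 0}"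

definition simple :: "('x::ab_group_add, 'm) root_datum_scheme \<Rightarrow> 'x set" where
  "simple R = {\<alpha> \<in> pos R. \<not> (\<exists>\<beta>\<in>pos R. \<exists>\<gamma>\<in>pos R. \<alpha> = \<beta> + \<gamma>)}"

text \<open>Reflections are involutions, so closure under composition already gives a group.\<close>

inductive_set weyl :: "('x::ab_group_add, 'm) root_datum_scheme \<Rightarrow> ('x \<Rightarrow> 'x) set"
  for R :: "('x, 'm) root_datum_scheme" where
  "id \<in> weyl R"
| "w \<in> weyl R \<Longrightarrow> \<alpha> \<in> roots R \<Longrightarrow> reflection R \<alpha> \<circ> w \<in> weyl R"

definition len :: "('x::ab_group_add, 'm) root_datum_scheme \<Rightarrow> ('x \<Rightarrow> 'x) \<Rightarrow> nat" where
  "len R w = (LEAST n. \<exists>ss. length ss = n \<and> set ss \<subseteq> reflection R ` simple R \<and> foldr (\<circ>) ss id = w)"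

definition bruhat_le ::
  "('x::ab_group_add, 'm) root_datum_scheme \<Rightarrow> ('x \<Rightarrow> 'x) \<Rightarrow> ('x \<Rightarrow> 'x) \<Rightarrow> bool" where
  "bruhat_le R u v \<longleftrightarrow>
     (u, v) \<in> {(x, x \<circ> reflection R \<alpha>) | x \<alpha>. x \<in> weyl R \<and> \<alpha> \<in> roots R \<and> len R x < len R (x \<circ> reflection R \<alpha>)}\<^sup>*"

definition bruhat_interval ::
  "('x::ab_group_add, 'm) root_datum_scheme \<Rightarrow> ('x \<Rightarrow> 'x) \<Rightarrow> ('x \<Rightarrow> 'x) \<Rightarrow> ('x \<Rightarrow> 'x) set" where
  "bruhat_interval R u v = {x \<in> weyl R. bruhat_le R u x \<and> bruhat_le R x v}"


section \<open>Rational functions in q and z\<close>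

text \<open>
  The coordinate ring of the torus is the group algebra of its character lattice, in which
  \<open>Poly_Mapping.single \<nu> 1\<close> is the function sending \<open>z\<close> to the value of \<open>\<nu>\<close> at \<open>z\<close>.
\<close>

type_synonym 'x torus_fun = "'x \<Rightarrow>\<^sub>0 complex"
type_synonym 'x torus_rat = "'x torus_fun fract"
type_synonym 'x ratfun = "'x torus_rat poly fract"

definition emb :: "'a::idom \<Rightarrow> 'a fract" where
  "emb a = Fraction_Field.Fract a 1"

definition const :: "'x::linordered_ab_group_add torus_rat \<Rightarrow> 'x ratfun" where
  "const c = emb [:c:]"

definition qvar :: "'x::linordered_ab_group_add ratfun" where
  "qvar = emb [:0, 1:]"

definition zpow :: "'x::linordered_ab_group_add \<Rightarrow> 'x ratfun" where
  "zpow \<nu> = const (emb (Poly_Mapping.single \<nu> 1))"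

text \<open>The extension to the fraction field of an injective ring homomorphism into a field.\<close>

definition fract_ext :: "('a::idom \<Rightarrow> 'b::field) \<Rightarrow> 'a fract \<Rightarrow> 'b" where
  "fract_ext \<phi> x = (THE y. \<exists>a b. b \<noteq> 0 \<and> x = Fraction_Field.Fract a b \<and> y = \<phi> a / \<phi> b)"

definition bar :: "'x::linordered_ab_group_add ratfun \<Rightarrow> 'x ratfun" where
  "bar = fract_ext (\<lambda>p. poly (map_poly const p) (inverse qvar))"

text \<open>
  Substitution of \<open>w z\<close> for \<open>z\<close>, where the value of \<open>\<nu>\<close> at \<open>w z\<close> is that of \<open>inv w \<nu>\<close> at \<open>z\<close>: first
  for regular functions on the torus, then for rational functions of \<open>z\<close>, then for rational
  functions of q and \<open>z\<close>.
\<close>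

definition subst_fun ::
  "('x \<Rightarrow> 'x) \<Rightarrow> 'x::linordered_ab_group_add torus_fun \<Rightarrow> 'x torus_fun" where
  "subst_fun w f =
     (\<Sum>\<nu>\<in>Poly_Mapping.keys f. Poly_Mapping.single (inv w \<nu>) (Poly_Mapping.lookup f \<nu>))"

definition subst_rat ::
  "('x \<Rightarrow> 'x) \<Rightarrow> 'x::linordered_ab_group_add torus_rat \<Rightarrow> 'x torus_rat" where
  "subst_rat w = fract_ext (\<lambda>f. emb (subst_fun w f))"

definition subst :: "('x \<Rightarrow> 'x) \<Rightarrow> 'x::linordered_ab_group_add ratfun \<Rightarrow> 'x ratfun" where
  "subst w = fract_ext (\<lambda>p. emb (map_poly (subst_rat w) p))"

definition q_pow ::
  "('x::linordered_ab_group_add, 'm) root_datum_scheme \<Rightarrow> ('x \<Rightarrow> 'x) \<Rightarrow> 'x ratfun" where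
  "q_pow R w = qvar ^ len R w"

definition eps ::
  "('x::linordered_ab_group_add, 'm) root_datum_scheme \<Rightarrow> ('x \<Rightarrow> 'x) \<Rightarrow> 'x ratfun" where
  "eps R w = (- 1) ^ len R w"


section \<open>The Hecke algebra\<close>

text \<open>
  \<open>'h\<close> with scalar multiplication \<open>scale\<close> is an associative unital algebra over the rational
  functions with basis \<open>T w\<close>, \<open>w\<close> in the Weyl group. These conditions determine it up to a unique
  isomorphism matching the bases.
\<close>

locale hecke_algebra = vector_space scale
  for scale :: "'x::linordered_ab_group_add ratfun \<Rightarrow> 'h::ring_1 \<Rightarrow> 'h" +
  fixes R :: "('x, 'm) root_datum_scheme"
    and T :: "('x \<Rightarrow> 'x) \<Rightarrow> 'h"
  assumes scale_mult_left: "scale c h * h' = scale c (h * h')"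
    and scale_mult_right: "h * scale c h' = scale c (h * h')"
    and T_inj: "inj_on T (weyl R)"
    and T_independent: "independent (T ` weyl R)"
    and T_span: "span (T ` weyl R) = UNIV"
    and T_mult: "w \<in> weyl R \<Longrightarrow> w' \<in> weyl R \<Longrightarrow> len R (w \<circ> w') = len R w + len R w' \<Longrightarrow>
      T w * T w' = T (w \<circ> w')"
    and T_quadratic: "\<alpha> \<in> simple R \<Longrightarrow>
      T (reflection R \<alpha>) * T (reflection R \<alpha>) = scale (qvar - 1) (T (reflection R \<alpha>)) + scale qvar 1"

definition T_coeff ::
  "('x::linordered_ab_group_add ratfun \<Rightarrow> 'h::ring_1 \<Rightarrow> 'h) \<Rightarrow> ('x, 'm) root_datum_scheme \<Rightarrow>
   (('x \<Rightarrow> 'x) \<Rightarrow> 'h) \<Rightarrow> 'h \<Rightarrow> ('x \<Rightarrow> 'x) \<Rightarrow> 'x ratfun" where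
  "T_coeff scale R T h w = module.representation scale (T ` weyl R) h (T w)"

definition hecke_subst ::
  "('x::linordered_ab_group_add ratfun \<Rightarrow> 'h::ring_1 \<Rightarrow> 'h) \<Rightarrow> ('x, 'm) root_datum_scheme \<Rightarrow>
   (('x \<Rightarrow> 'x) \<Rightarrow> 'h) \<Rightarrow> ('x \<Rightarrow> 'x) \<Rightarrow> 'h \<Rightarrow> 'h" where
  "hecke_subst scale R T w h = (\<Sum>x\<in>weyl R. scale (subst w (T_coeff scale R T h x)) (T x))"

text \<open>
  The family \<open>\<mu>\<^sub>z(w)\<close> with \<open>z\<close> the generic point of the torus; \<open>\<mu>\<^bsub>w'z\<^esub>(w)\<close> is obtained from it by
  substituting \<open>w' z\<close> for \<open>z\<close> in the coefficients. The conditions determine \<open>\<mu>\<close> on the Weyl group.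
\<close>

locale mu_family = hecke_algebra scale R T
  for scale :: "'x::linordered_ab_group_add ratfun \<Rightarrow> 'h::ring_1 \<Rightarrow> 'h"
    and R :: "('x, 'm) root_datum_scheme"
    and T :: "('x \<Rightarrow> 'x) \<Rightarrow> 'h" +
  fixes \<mu> :: "('x \<Rightarrow> 'x) \<Rightarrow> 'h"
  assumes mu_one: "\<mu> id = 1"
    and mu_simple: "\<alpha> \<in> simple R \<Longrightarrow> \<mu> (reflection R \<alpha>) =
      scale (inverse qvar) (T (reflection R \<alpha>)) +
      scale ((1 - inverse qvar) * (zpow \<alpha> / (1 - zpow \<alpha>))) 1"
    and mu_mult: "w1 \<in> weyl R \<Longrightarrow> w2 \<in> weyl R \<Longrightarrow> len R (w1 \<circ> w2) = len R w1 + len R w2 \<Longrightarrow>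
      \<mu> (w1 \<circ> w2) = \<mu> w2 * hecke_subst scale R T w2 (\<mu> w1)"

text \<open>
  Solved for \<open>r_fun\<close>, the defining expansion says that the coefficient of \<open>T (inv u)\<close> in \<open>\<mu> v\<close> is
  \<open>inverse (q_pow R u) * bar (r_fun u v)\<close>; note that \<open>bar\<close> is an involution.
\<close>

definition r_fun ::
  "('x::linordered_ab_group_add ratfun \<Rightarrow> 'h::ring_1 \<Rightarrow> 'h) \<Rightarrow> ('x, 'm) root_datum_scheme \<Rightarrow>
   (('x \<Rightarrow> 'x) \<Rightarrow> 'h) \<Rightarrow> (('x \<Rightarrow> 'x) \<Rightarrow> 'h) \<Rightarrow> ('x \<Rightarrow> 'x) \<Rightarrow> ('x \<Rightarrow> 'x) \<Rightarrow> 'x ratfun" where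
  "r_fun scale R T \<mu> u v = bar (q_pow R u * T_coeff scale R T (\<mu> v) (inv u))"

definition Lambda ::
  "('x::linordered_ab_group_add ratfun \<Rightarrow> 'h::ring_1 \<Rightarrow> 'h) \<Rightarrow> ('x, 'm) root_datum_scheme \<Rightarrow>
   (('x \<Rightarrow> 'x) \<Rightarrow> 'h) \<Rightarrow> 'h \<Rightarrow> 'x ratfun" where
  "Lambda scale R T =
     vector_space_pair.construct scale (*) (T ` weyl R) (\<lambda>b. if b = T id then 1 else 0)"

definition psi ::
  "('x::ab_group_add, 'm) root_datum_scheme \<Rightarrow> (('x \<Rightarrow> 'x) \<Rightarrow> 'h::ring_1) \<Rightarrow> ('x \<Rightarrow> 'x) \<Rightarrow> 'h" where
  "psi R T u = (\<Sum>x | x \<in> weyl R \<and> bruhat_le R u x. T x)"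

definition m_fun ::
  "('x::linordered_ab_group_add ratfun \<Rightarrow> 'h::ring_1 \<Rightarrow> 'h) \<Rightarrow> ('x, 'm) root_datum_scheme \<Rightarrow>
   (('x \<Rightarrow> 'x) \<Rightarrow> 'h) \<Rightarrow> (('x \<Rightarrow> 'x) \<Rightarrow> 'h) \<Rightarrow> ('x \<Rightarrow> 'x) \<Rightarrow> ('x \<Rightarrow> 'x) \<Rightarrow> 'x ratfun" where
  "m_fun scale R T \<mu> u v = Lambda scale R T (psi R T u * \<mu> v)"

end

theory Submission
  imports Defs "HOL-Library.FuncSet"
begin

text \<open>
  Since \<open>\<Lambda>(T\<^sub>x T\<^sub>y)\<close> is \<open>q\<^sub>x\<close> if \<open>x y = 1\<close> and zero otherwise, \<open>\<Lambda>(T\<^sub>x \<mu>(v))\<close> is the conjugate of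
  \<open>r\<^bsub>x,v\<^esub>\<close>. Summing over \<open>x \<ge> u\<close> gives the first formula, because \<open>\<mu>(v)\<close> only involves \<open>T\<^sub>w\<close> with
  \<open>w\<^sup>-\<^sup>1 \<le> v\<close>. The second formula is its Moebius inversion, by Verma's theorem that the signed number of
  elements of a nontrivial Bruhat interval is zero. The Coxeter theory of the Weyl group all comes
  from two facts: a simple reflection permutes the other positive roots, and a reflection
  increases the length of \<open>w\<close> exactly if \<open>w\<close> keeps its positive root positive.
\<close>

section \<open>Roots and reflections\<close>

text \<open>The obstacle is the generality of the root datum. The roots may span a proper
  sublattice, and the axioms speak only of roots and coroots, so an invariant form has to be built.
  The form summed over the coroots is only semidefinite: a vanishing norm says that all coroots
  vanish on an element, not that the element is 0, and such arguments have to end with an equality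
  of coroots. Right multiplication dominates because a Bruhat step multiplies by a reflection on the
  right. The rule for \<mu> reverses products, so a right factor of v acts from the left in the
  algebra; this is why inverses appear in the support of \<mu>(v). The coefficients of \<mu>(v) are
  never computed. What matters is where they vanish, and substituting w z for z sends 0 to 0. The
  exchange of q and its inverse, in contrast, is applied to whole sums and has to cancel when done
  twice, so it is shown to be an involutive homomorphism.\<close>

lemma zmult_0 [simp]: "zmult 0 x = 0"
  by (simp add: zmult_def)

lemma zmult_1 [simp]: "zmult 1 x = x"
  by (simp add: zmult_def)

lemma zmult_succ: "zmult (k + 1) x = zmult k x + x"
proof (cases "0 \<le> k")
  case True
  then have "nat (k + 1) = Suc (nat k)" by simp
  with True show ?thesis by (simp add: zmult_def add.commute)
next
  case False
  then have "nat (- k) = Suc (nat (- (k + 1)))" by simp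
  then have "zmult k x = - (x + ((+) x ^^ nat (- (k + 1))) 0)"
    using False by (simp add: zmult_def)
  moreover have "zmult (k + 1) x = - (((+) x ^^ nat (- (k + 1))) 0)"
    using False by (auto simp: zmult_def)
  ultimately show ?thesis by (simp only: minus_add_distrib) simp
qed

lemma zmult_pred: "zmult (k - 1) x = zmult k x - x"
  using zmult_succ[of "k - 1" x] by (simp add: algebra_simps)

lemma zmult_add: "zmult (a + b) x = zmult a x + zmult b x"
proof (induction b rule: int_induct[where k = 0])
  case base
  show ?case by simp
next
  case (step1 i)
  have "zmult (a + (i + 1)) x = zmult (a + i + 1) x" by (simp only: add.assoc)
  also have "\<dots> = zmult a x + zmult i x + x" by (simp only: zmult_succ step1)
  finally show ?case by (simp only: zmult_succ add.assoc)
next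
  case (step2 i)
  have "zmult (a + (i - 1)) x = zmult (a + i - 1) x" by (simp only: add_diff_eq)
  also have "\<dots> = zmult a x + zmult i x - x" by (simp only: zmult_pred step2)
  finally show ?case by (simp only: zmult_pred add_diff_eq)
qed

lemma zmult_minus: "zmult (- k) x = - zmult k x"
  using zmult_add[of k "- k" x] by (simp add: eq_neg_iff_add_eq_0 add.commute)

lemma zmult_2: "zmult 2 x = x + x"
  using zmult_add[of 1 1 x] by simp

text \<open>The codomain is an arbitrary group because the map will be a coroot, \<open>ht\<close>,
  the form in one argument or an element of the Weyl group.\<close>

lemma additive_zmult:
  assumes add: "\<And>x y. f (x + y) = f x + f y"
  shows "f (zmult k x) = zmult k (f x)"
proof -
  have f0: "f 0 = 0" using add[of 0 0] by simp
  have fd: "f (x - y) = f x - f y" for x y using add[of "x - y" y] by simp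
  show ?thesis
    by (induction k rule: int_induct[where k = 0]) (simp_all add: f0 zmult_succ zmult_pred add fd)
qed

lemma zmult_int: "zmult k (n::int) = k * n"
  by (induction k rule: int_induct[where k = 0]) (simp_all add: zmult_succ zmult_pred algebra_simps)

lemma zmult_real: "zmult k (r::real) = of_int k * r"
  by (induction k rule: int_induct[where k = 0]) (simp_all add: zmult_succ zmult_pred algebra_simps)

context based_root_datum
begin

abbreviation "rfl \<equiv> reflection R"

text \<open>The sum over the coroots makes this form invariant before the Weyl group is known to be
  finite.\<close>

definition form :: "'x \<Rightarrow> 'x \<Rightarrow> int" where
  "form x y = (\<Sum>c\<in>coroot R ` roots R. c x * c y)"

text \<open>One functional from \<open>pos_half_space\<close>, fixed once. It takes the place of the
  height of a root. Its values are real, so inductions along it count the positive roots with a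
  smaller value.\<close>

definition ht :: "'x \<Rightarrow> real" where
  "ht = (SOME h. (\<forall>\<nu> \<nu>'. h (\<nu> + \<nu>') = h \<nu> + h \<nu>') \<and>
      (\<forall>\<alpha>\<in>roots R. h \<alpha> \<noteq> 0) \<and> pos R = {\<alpha> \<in> roots R. h \<alpha> > 0})"

lemma ht: "(\<forall>\<nu> \<nu>'. ht (\<nu> + \<nu>') = ht \<nu> + ht \<nu>') \<and>
      (\<forall>\<alpha>\<in>roots R. ht \<alpha> \<noteq> 0) \<and> pos R = {\<alpha> \<in> roots R. ht \<alpha> > 0}"
  unfolding ht_def by (rule someI_ex[OF pos_half_space])

lemma ht_add: "ht (x + y) = ht x + ht y"
  using ht by blast

lemma ht_0: "ht 0 = 0"
  using ht_add[of 0 0] by simp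

lemma ht_minus: "ht (- x) = - ht x"
  using ht_add[of x "- x"] by (simp add: ht_0)

lemma ht_diff: "ht (x - y) = ht x - ht y"
  using ht_add[of x "- y"] by (simp add: ht_minus)

lemma ht_nonzero: "\<alpha> \<in> roots R \<Longrightarrow> ht \<alpha> \<noteq> 0"
  using ht by blast

lemma pos_iff: "\<alpha> \<in> pos R \<longleftrightarrow> \<alpha> \<in> roots R \<and> ht \<alpha> > 0"
  using ht by blast

lemma pos_root: "\<alpha> \<in> pos R \<Longrightarrow> \<alpha> \<in> roots R"
  by (simp add: pos_iff)

lemma simple_pos: "\<alpha> \<in> simple R \<Longrightarrow> \<alpha> \<in> pos R"
  by (simp add: simple_def)

lemma simple_root: "\<alpha> \<in> simple R \<Longrightarrow> \<alpha> \<in> roots R"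
  by (simp add: simple_pos pos_root)

lemma simple_indecomposable:
  "\<alpha> \<in> simple R \<Longrightarrow> \<beta> \<in> pos R \<Longrightarrow> \<gamma> \<in> pos R \<Longrightarrow> \<alpha> \<noteq> \<beta> + \<gamma>"
  by (auto simp: simple_def)

lemma coroot_zmult: "\<alpha> \<in> roots R \<Longrightarrow> coroot R \<alpha> (zmult k x) = k * coroot R \<alpha> x"
  by (subst additive_zmult) (simp_all add: coroot_additive zmult_int)

lemma coroot_diff: "\<alpha> \<in> roots R \<Longrightarrow> coroot R \<alpha> (x - y) = coroot R \<alpha> x - coroot R \<alpha> y"
  using coroot_additive[of \<alpha> "x - y" y] by simp

lemma coroot_refl:
  "\<alpha> \<in> roots R \<Longrightarrow> \<beta> \<in> roots R \<Longrightarrow>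
    coroot R \<beta> (rfl \<alpha> x) = coroot R \<beta> x - coroot R \<beta> \<alpha> * coroot R \<alpha> x"
  by (simp add: reflection_def coroot_diff coroot_zmult)

lemma refl_add: "\<alpha> \<in> roots R \<Longrightarrow> rfl \<alpha> (x + y) = rfl \<alpha> x + rfl \<alpha> y"
  by (simp add: reflection_def coroot_additive zmult_add algebra_simps)

lemma refl_self: "\<alpha> \<in> roots R \<Longrightarrow> rfl \<alpha> \<alpha> = - \<alpha>"
  by (simp add: reflection_def coroot_self zmult_2)

lemma refl_refl [simp]: "\<alpha> \<in> roots R \<Longrightarrow> rfl \<alpha> (rfl \<alpha> x) = x"
  using coroot_refl[of \<alpha> \<alpha> x]
  by (simp add: reflection_def[of R \<alpha> "rfl \<alpha> x"] coroot_self zmult_minus)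
     (simp add: reflection_def)

lemma refl_comp_self: "\<alpha> \<in> roots R \<Longrightarrow> rfl \<alpha> \<circ> rfl \<alpha> = id"
  by (rule ext) simp

lemma refl_root: "\<alpha> \<in> roots R \<Longrightarrow> \<beta> \<in> roots R \<Longrightarrow> rfl \<alpha> \<beta> \<in> roots R"
  using refl_roots by blast

lemma minus_root: "\<alpha> \<in> roots R \<Longrightarrow> - \<alpha> \<in> roots R"
  using refl_root[of \<alpha> \<alpha>] by (simp add: refl_self)

lemma pos_or_neg: "\<alpha> \<in> roots R \<Longrightarrow> \<alpha> \<in> pos R \<or> - \<alpha> \<in> pos R"
  using ht_nonzero[of \<alpha>] by (auto simp: pos_iff ht_minus minus_root)

lemma not_pos_and_neg: "\<alpha> \<in> pos R \<Longrightarrow> - \<alpha> \<notin> pos R"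
  by (simp add: pos_iff ht_minus)

section \<open>The invariant form\<close>

lemma form_add_left: "form (x + y) z = form x z + form y z"
  unfolding form_def sum.distrib[symmetric]
  by (rule sum.cong) (auto simp: coroot_additive distrib_right)

lemma form_commute: "form x y = form y x"
  by (simp add: form_def mult.commute)

lemma form_add_right: "form z (x + y) = form z x + form z y"
  using form_add_left[of x y z] by (simp add: form_commute)

lemma form_minus_left: "form (- x) z = - form x z"
  using form_add_left[of x "- x" z] form_add_left[of 0 0 z] by simp

lemma form_minus_right: "form z (- x) = - form z x"
  using form_minus_left[of x z] by (simp add: form_commute)

lemma form_diff_left: "form (x - y) z = form x z - form y z"
  using form_add_left[of "x - y" y z] by simp

lemma form_diff_right: "form z (x - y) = form z x - form z y"
  using form_add_right[of z "x - y" y] by simp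

lemma form_zmult_left: "form (zmult k x) z = k * form x z"
  by (subst additive_zmult[of "\<lambda>x. form x z"]) (simp_all add: form_add_left zmult_int)

lemma form_nonneg: "form x x \<ge> 0"
  unfolding form_def by (intro sum_nonneg) simp

text \<open>The coroot of \<alpha> itself contributes the square of 2 to a sum of squares.\<close>

lemma form_root_pos: "\<alpha> \<in> roots R \<Longrightarrow> form \<alpha> \<alpha> > 0"
  unfolding form_def by (rule sum_pos2[of _ "coroot R \<alpha>"]) (auto simp: finite_roots coroot_self)

lemma form_zero_coroot:
  assumes "form x x = 0" "\<alpha> \<in> roots R"
  shows "coroot R \<alpha> x = 0"
  using assms unfolding form_def by (subst (asm) sum_nonneg_eq_0_iff) (auto simp: finite_roots)

text \<open>Composing a coroot with \<open>rfl \<alpha>\<close> is the dual reflection, which by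
  \<open>refl_coroots\<close> permutes the index set of the sum.\<close>

lemma form_refl:
  assumes "\<alpha> \<in> roots R"
  shows "form (rfl \<alpha> x) (rfl \<alpha> y) = form x y"
proof -
  let ?C = "coroot R ` roots R"
  let ?g = "\<lambda>y \<nu>. y \<nu> - y \<alpha> * coroot R \<alpha> \<nu>"
  have fin: "finite ?C" by (simp add: finite_roots)
  have im: "?g ` ?C = ?C" by (rule refl_coroots[OF assms])
  have inj: "inj_on ?g ?C" by (rule eq_card_imp_inj_on[OF fin]) (simp only: im)
  have "form x y = (\<Sum>c\<in>?g ` ?C. c x * c y)" by (simp only: im form_def)
  also have "\<dots> = (\<Sum>c\<in>?C. ?g c x * ?g c y)" by (subst sum.reindex[OF inj]) simp
  also have "\<dots> = form (rfl \<alpha> x) (rfl \<alpha> y)"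
    unfolding form_def by (rule sum.cong) (auto simp: coroot_refl assms)
  finally show ?thesis by simp
qed

text \<open>The usual formula for a coroot, with the division cleared because the form is integral.
  It follows from invariance, as \<open>rfl \<alpha>\<close> negates \<alpha>, and it makes the sign
  of the pairing symmetric in two roots.\<close>

lemma form_coroot:
  assumes "\<alpha> \<in> roots R"
  shows "2 * form x \<alpha> = coroot R \<alpha> x * form \<alpha> \<alpha>"
proof -
  have "form x \<alpha> = form (rfl \<alpha> x) (rfl \<alpha> \<alpha>)" by (simp add: form_refl assms)
  also have "\<dots> = - form x \<alpha> + coroot R \<alpha> x * form \<alpha> \<alpha>"
    by (simp only: refl_self[OF assms] form_minus_right)
       (simp add: reflection_def form_diff_left form_zmult_left)
  finally show ?thesis by simp
qed

lemma coroot_pos_iff: "\<alpha> \<in> roots R \<Longrightarrow> coroot R \<alpha> x > 0 \<longleftrightarrow> form x \<alpha> > 0"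
  using form_coroot[of \<alpha> x] form_root_pos[of \<alpha>] by (smt (verit) zero_less_mult_iff)

text \<open>If both pairings were at least 2, the norm of \<open>\<alpha> - \<beta>\<close> would vanish, and the two coroots
  would coincide.\<close>

lemma coroot_pairing_1:
  assumes a: "\<alpha> \<in> roots R" and b: "\<beta> \<in> roots R" and ne: "\<alpha> \<noteq> \<beta>" and p: "coroot R \<alpha> \<beta> > 0"
  shows "coroot R \<alpha> \<beta> = 1 \<or> coroot R \<beta> \<alpha> = 1"
proof (rule ccontr)
  assume neg: "\<not> ?thesis"
  have fp: "form \<beta> \<alpha> > 0" using p coroot_pos_iff[OF a] by simp
  then have "coroot R \<beta> \<alpha> > 0" using coroot_pos_iff[OF b] by (simp add: form_commute)
  then have ge: "coroot R \<alpha> \<beta> \<ge> 2" "coroot R \<beta> \<alpha> \<ge> 2" using neg p by auto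
  have "2 * form \<alpha> \<alpha> \<le> coroot R \<alpha> \<beta> * form \<alpha> \<alpha>"
    using ge(1) form_nonneg by (intro mult_right_mono) auto
  then have 1: "form \<alpha> \<alpha> \<le> form \<beta> \<alpha>" using form_coroot[OF a, of \<beta>] by simp
  have "2 * form \<beta> \<beta> \<le> coroot R \<beta> \<alpha> * form \<beta> \<beta>"
    using ge(2) form_nonneg by (intro mult_right_mono) auto
  then have 2: "form \<beta> \<beta> \<le> form \<beta> \<alpha>" using form_coroot[OF b, of \<alpha>] by (simp add: form_commute)
  have "form (\<alpha> - \<beta>) (\<alpha> - \<beta>) = form \<alpha> \<alpha> + form \<beta> \<beta> - 2 * form \<beta> \<alpha>"
    using form_commute[of \<alpha> \<beta>] by (simp add: form_diff_left form_diff_right)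
  with 1 2 form_nonneg[of "\<alpha> - \<beta>"] have z: "form (\<alpha> - \<beta>) (\<alpha> - \<beta>) = 0"
    and eq: "form \<alpha> \<alpha> = form \<beta> \<beta>" by auto
  have "form x \<alpha> = form x \<beta>" for x
  proof -
    have "form x (\<alpha> - \<beta>) = 0"
      unfolding form_def by (rule sum.neutral) (auto simp: form_zero_coroot[OF z])
    then show ?thesis by (simp add: form_diff_right)
  qed
  then have "coroot R \<alpha> x * form \<alpha> \<alpha> = coroot R \<beta> x * form \<alpha> \<alpha>" for x
    using form_coroot[OF a, of x] form_coroot[OF b, of x] unfolding eq by presburger
  then have "coroot R \<alpha> = coroot R \<beta>" using form_root_pos[OF a] by (auto intro!: ext)
  with ne show False using coroot_inj a b by (auto dest: inj_onD)
qed

text \<open>Otherwise \<open>\<alpha> - \<beta>\<close> is positive, and adding \<beta> to it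
  decomposes \<alpha>.\<close>

lemma diff_simple_pos:
  assumes "\<alpha> \<in> simple R" "\<beta> \<in> pos R" "\<beta> - \<alpha> \<in> roots R"
  shows "\<beta> - \<alpha> \<in> pos R"
  using pos_or_neg[OF assms(3)] simple_indecomposable[OF assms(1,2), of "\<alpha> - \<beta>"] by auto

text \<open>A case distinction on the pairing replaces the expansion of roots in simple ones. A
  pairing of at most 0 adds a nonnegative multiple of \<alpha>, and pairing 1 subtracts \<alpha>
  once. If it is at least 2, the opposite pairing is 1, so \<open>\<beta> - \<alpha>\<close> is a
  root, and its pairing is smaller by 2.\<close>

lemma simple_refl_pos:
  assumes "\<alpha> \<in> simple R" "\<beta> \<in> pos R" "\<beta> \<noteq> \<alpha>"
  shows "rfl \<alpha> \<beta> \<in> pos R"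
  using assms(2,3)
proof (induction "nat (coroot R \<alpha> \<beta>)" arbitrary: \<beta> rule: less_induct)
  case less
  have a: "\<alpha> \<in> roots R" "\<alpha> \<in> pos R" by (auto simp: assms simple_root simple_pos)
  have b: "\<beta> \<in> roots R" using less pos_root by blast
  have r: "rfl \<alpha> \<beta> \<in> roots R" using refl_root a b by blast
  let ?n = "coroot R \<alpha> \<beta>"
  consider "?n \<le> 0" | "?n = 1" | "?n \<ge> 2" by linarith
  then show ?case
  proof cases
    case 1
    have "ht (rfl \<alpha> \<beta>) = ht \<beta> - of_int ?n * ht \<alpha>"
      using additive_zmult[of ht ?n \<alpha>] by (simp add: reflection_def ht_diff ht_add zmult_real)
    moreover have "of_int ?n * ht \<alpha> \<le> 0" using 1 a by (simp add: pos_iff mult_nonpos_nonneg)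
    ultimately show ?thesis using r less(2) by (simp add: pos_iff)
  next
    case 2
    then have "rfl \<alpha> \<beta> = \<beta> - \<alpha>" by (simp add: reflection_def)
    then show ?thesis using diff_simple_pos[OF assms(1) less(2)] r by simp
  next
    case 3
    with coroot_pairing_1[OF a(1) b] less(3) have "coroot R \<beta> \<alpha> = 1" by auto
    then have "rfl \<beta> \<alpha> = \<alpha> - \<beta>" by (simp add: reflection_def)
    then have "\<beta> - \<alpha> \<in> roots R" using refl_root[OF b a(1)] minus_root[of "\<alpha> - \<beta>"] by simp
    then have p: "\<beta> - \<alpha> \<in> pos R" using diff_simple_pos[OF assms(1) less(2)] by simp
    have ne: "\<beta> - \<alpha> \<noteq> \<alpha>" using reduced[OF a(1)] b by (metis diff_add_cancel)
    have "coroot R \<alpha> (\<beta> - \<alpha>) = ?n - 2" using a by (simp add: coroot_diff coroot_self)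
    then have ih: "rfl \<alpha> (\<beta> - \<alpha>) \<in> pos R" using 3 less(1)[OF _ p ne] by simp
    have e: "rfl \<alpha> (\<beta> - \<alpha>) = rfl \<alpha> \<beta> + \<alpha>"
      using refl_add[OF a(1), of "\<beta> - \<alpha>" \<alpha>] refl_self[OF a(1)] by (simp add: algebra_simps)
    \<comment> \<open>If \<open>rfl \<alpha> \<beta>\<close> were negative, \<alpha> would be the
      sum of the positive roots \<open>rfl \<alpha> (\<beta> - \<alpha>)\<close> and
      \<open>- rfl \<alpha> \<beta>\<close>.\<close>
    show ?thesis
    proof (rule ccontr)
      assume "rfl \<alpha> \<beta> \<notin> pos R"
      then have "- rfl \<alpha> \<beta> \<in> pos R" using pos_or_neg[OF r] by blast
      from simple_indecomposable[OF assms(1) ih this] e show False by simp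
    qed
  qed
qed

text \<open>Decomposing positive roots down to simple ones, nonpositive pairings of \<beta> with all
  simple roots would spread to all positive roots, hence to \<beta> itself.\<close>

lemma pos_simple_form_pos:
  assumes "\<beta> \<in> pos R"
  shows "\<exists>\<alpha>\<in>simple R. form \<beta> \<alpha> > 0"
proof (rule ccontr)
  assume neg: "\<not> ?thesis"
  have "form \<beta> \<gamma> \<le> 0" if "\<gamma> \<in> pos R" for \<gamma>
    using that
  proof (induction "card {\<delta> \<in> pos R. ht \<delta> < ht \<gamma>}" arbitrary: \<gamma> rule: less_induct)
    case less
    have fin: "finite (pos R)" by (rule finite_subset[OF _ finite_roots]) (auto simp: pos_root)
    show ?case
    proof (cases "\<gamma> \<in> simple R")
      case True
      then show ?thesis using neg by force
    next
      case False
      then obtain \<delta> \<epsilon> where d: "\<delta> \<in> pos R" "\<epsilon> \<in> pos R" "\<gamma> = \<delta> + \<epsilon>"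
        using less(2) by (auto simp: simple_def)
      have "form \<beta> \<zeta> \<le> 0" if z: "\<zeta> \<in> pos R" "ht \<zeta> < ht \<gamma>" for \<zeta>
      proof (rule less(1)[OF _ z(1)])
        show "card {\<delta> \<in> pos R. ht \<delta> < ht \<zeta>} < card {\<delta> \<in> pos R. ht \<delta> < ht \<gamma>}"
          using z fin by (intro psubset_card_mono) auto
      qed
      then show ?thesis using d by (auto simp: form_add_right pos_iff ht_add add_nonpos_nonpos)
    qed
  qed
  from this[OF assms] form_root_pos[OF pos_root[OF assms]] show False by simp
qed

section \<open>The Weyl group as a Coxeter group\<close>

lemma weyl_comp: "u \<in> weyl R \<Longrightarrow> w \<in> weyl R \<Longrightarrow> u \<circ> w \<in> weyl R"
proof (induction u rule: weyl.induct)
  case 1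
  then show "id \<circ> w \<in> weyl R" by simp
next
  case (2 u \<alpha>)
  then have "u \<circ> w \<in> weyl R" by blast
  with 2 show "rfl \<alpha> \<circ> u \<circ> w \<in> weyl R"
    using weyl.intros(2)[of "u \<circ> w" R \<alpha>] by (simp only: comp_assoc)
qed

lemma refl_weyl: "\<alpha> \<in> roots R \<Longrightarrow> rfl \<alpha> \<in> weyl R"
  using weyl.intros(2)[OF weyl.intros(1), of \<alpha> R] by simp

lemma weyl_root: "w \<in> weyl R \<Longrightarrow> \<alpha> \<in> roots R \<Longrightarrow> w \<alpha> \<in> roots R"
  by (induction rule: weyl.induct) (auto simp: refl_root)

lemma weyl_add: "w \<in> weyl R \<Longrightarrow> w (x + y) = w x + w y"
  by (induction rule: weyl.induct) (auto simp: refl_add)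

lemma weyl_minus: "w \<in> weyl R \<Longrightarrow> w (- x) = - w x"
  using weyl_add[of w x "- x"] weyl_add[of w 0 0] by (simp add: eq_neg_iff_add_eq_0 add.commute)

lemma weyl_form: "w \<in> weyl R \<Longrightarrow> form (w x) (w y) = form x y"
  by (induction rule: weyl.induct) (auto simp: form_refl)

lemma bij_refl: "\<alpha> \<in> roots R \<Longrightarrow> bij (rfl \<alpha>)"
  by (rule o_bij[of "rfl \<alpha>"]) (simp_all add: refl_comp_self)

lemma inv_refl: "\<alpha> \<in> roots R \<Longrightarrow> inv (rfl \<alpha>) = rfl \<alpha>"
  by (rule inv_unique_comp) (simp_all add: refl_comp_self)

lemma bij_weyl: "w \<in> weyl R \<Longrightarrow> bij w"
  by (induction rule: weyl.induct) (intro bij_id bij_comp bij_refl; assumption)+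

lemma inv_weyl: "w \<in> weyl R \<Longrightarrow> inv w \<in> weyl R"
proof (induction rule: weyl.induct)
  case 1
  show "inv id \<in> weyl R" by (simp add: weyl.intros(1))
next
  case (2 w \<alpha>)
  then have "inv w \<circ> rfl \<alpha> \<in> weyl R" by (intro weyl_comp refl_weyl)
  with 2 show "inv (rfl \<alpha> \<circ> w) \<in> weyl R"
    by (simp add: o_inv_distrib bij_weyl bij_refl inv_refl)
qed

lemma weyl_inv_comp [simp]: "w \<in> weyl R \<Longrightarrow> inv w \<circ> w = id" "w \<in> weyl R \<Longrightarrow> w \<circ> inv w = id"
  using bij_weyl by (auto simp: bij_is_inj bij_is_surj surj_iff[symmetric])

lemma inv_comp_weyl: "u \<in> weyl R \<Longrightarrow> w \<in> weyl R \<Longrightarrow> inv (u \<circ> w) = inv w \<circ> inv u"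
  by (simp add: o_inv_distrib bij_weyl)

lemma inv_inv_weyl [simp]: "w \<in> weyl R \<Longrightarrow> inv (inv w) = w"
  by (simp add: bij_weyl inv_inv_eq)

lemma comp_refl_refl [simp]: "\<alpha> \<in> roots R \<Longrightarrow> w \<circ> rfl \<alpha> \<circ> rfl \<alpha> = w"
  by (simp add: comp_assoc refl_comp_self)

lemma refl_refl_comp [simp]: "\<alpha> \<in> roots R \<Longrightarrow> rfl \<alpha> \<circ> (rfl \<alpha> \<circ> w) = w"
  by (simp add: comp_assoc[symmetric] refl_comp_self)

text \<open>By \<open>form_coroot\<close> the form determines the coroots, so \<open>w\<close>,
  which preserves it, carries the coroot of \<beta> to that of \<open>w \<beta>\<close>.\<close>

lemma refl_conj:
  assumes w: "w \<in> weyl R" and b: "\<beta> \<in> roots R"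
  shows "rfl (w \<beta>) \<circ> w = w \<circ> rfl \<beta>"
proof
  fix x
  have wb: "w \<beta> \<in> roots R" using weyl_root w b by blast
  have "coroot R (w \<beta>) (w x) * form \<beta> \<beta> = coroot R \<beta> x * form \<beta> \<beta>"
    using form_coroot[OF wb, of "w x"] form_coroot[OF b, of x] unfolding weyl_form[OF w] by presburger
  then have e: "coroot R (w \<beta>) (w x) = coroot R \<beta> x" using form_root_pos[OF b] by auto
  have wd: "w (x - y) = w x - w y" for x y using weyl_add[OF w, of "x - y" y] by simp
  have "w (zmult k \<beta>) = zmult k (w \<beta>)" for k by (rule additive_zmult) (simp add: weyl_add w)
  then show "(rfl (w \<beta>) \<circ> w) x = (w \<circ> rfl \<beta>) x" by (simp add: reflection_def e wd)
qed

lemma refl_minus: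
  assumes "\<beta> \<in> roots R" shows "rfl (- \<beta>) = rfl \<beta>"
proof -
  have "rfl (- \<beta>) \<circ> rfl \<beta> = rfl \<beta> \<circ> rfl \<beta>"
    using refl_conj[OF refl_weyl[OF assms] assms] by (simp add: refl_self assms)
  then have "rfl (- \<beta>) \<circ> rfl \<beta> \<circ> rfl \<beta> = rfl \<beta> \<circ> rfl \<beta> \<circ> rfl \<beta>" by simp
  with assms show ?thesis by (simp only: comp_refl_refl)
qed

section \<open>Words in the simple reflections and length\<close>

definition word :: "('x \<Rightarrow> 'x) list \<Rightarrow> ('x \<Rightarrow> 'x) \<Rightarrow> bool" where
  "word ss w \<longleftrightarrow> set ss \<subseteq> rfl ` simple R \<and> foldr (\<circ>) ss id = w"

lemma foldr_comp: "foldr (\<circ>) ss g = foldr (\<circ>) ss id \<circ> g"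
  by (induction ss) (auto simp: comp_assoc)

lemma word_append: "word ss u \<Longrightarrow> word ts w \<Longrightarrow> word (ss @ ts) (u \<circ> w)"
  by (auto simp: word_def foldr_comp[of ss w] foldr_comp[of ss "foldr (\<circ>) ts id"])

lemma word_single: "\<alpha> \<in> simple R \<Longrightarrow> word [rfl \<alpha>] (rfl \<alpha>)"
  by (simp add: word_def)

text \<open>A simple \<alpha> that pairs positively with \<beta> lowers \<open>ht\<close>, and
  \<open>rfl \<beta>\<close> is conjugate under \<open>rfl \<alpha>\<close> to the reflection in the
  lower root. The descent can only end at a simple root.\<close>

lemma word_refl:
  assumes "\<beta> \<in> pos R"
  shows "\<exists>ss. word ss (rfl \<beta>)"
  using assms
proof (induction "card {\<delta> \<in> pos R. ht \<delta> < ht \<beta>}" arbitrary: \<beta> rule: less_induct)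
  case less
  have fin: "finite (pos R)" by (rule finite_subset[OF _ finite_roots]) (auto simp: pos_root)
  obtain \<alpha> where a: "\<alpha> \<in> simple R" "form \<beta> \<alpha> > 0" using pos_simple_form_pos less(2) by blast
  have ar: "\<alpha> \<in> roots R" "\<alpha> \<in> pos R" using a simple_root simple_pos by auto
  show ?case
  proof (cases "\<beta> = \<alpha>")
    case True
    then show ?thesis using word_single a by blast
  next
    case False
    let ?\<gamma> = "rfl \<alpha> \<beta>"
    have g: "?\<gamma> \<in> pos R" using simple_refl_pos a less False by blast
    have "ht ?\<gamma> = ht \<beta> - of_int (coroot R \<alpha> \<beta>) * ht \<alpha>"
      using additive_zmult[of ht "coroot R \<alpha> \<beta>" \<alpha>] by (simp add: reflection_def ht_diff ht_add zmult_real)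
    moreover have "coroot R \<alpha> \<beta> > 0" using coroot_pos_iff ar a by blast
    ultimately have lt: "ht ?\<gamma> < ht \<beta>" using ar by (simp add: pos_iff)
    have "card {\<delta> \<in> pos R. ht \<delta> < ht ?\<gamma>} < card {\<delta> \<in> pos R. ht \<delta> < ht \<beta>}"
      using lt g fin by (intro psubset_card_mono) auto
    from less(1)[OF this g] obtain ss where ss: "word ss (rfl ?\<gamma>)" by blast
    have "rfl ?\<gamma> \<circ> rfl \<alpha> = rfl \<alpha> \<circ> rfl \<beta>"
      using refl_conj[OF refl_weyl[OF ar(1)] pos_root[OF less(2)]] .
    then have "rfl \<beta> = rfl \<alpha> \<circ> (rfl ?\<gamma> \<circ> rfl \<alpha>)" using ar by simp
    moreover have "word ([rfl \<alpha>] @ ss @ [rfl \<alpha>]) (rfl \<alpha> \<circ> (rfl ?\<gamma> \<circ> rfl \<alpha>))"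
      by (intro word_append word_single a ss)
    ultimately show ?thesis by auto
  qed
qed

lemma word_ex: "w \<in> weyl R \<Longrightarrow> \<exists>ss. word ss w"
proof (induction rule: weyl.induct)
  case 1
  have "word [] id" by (simp add: word_def)
  then show ?case by blast
next
  case (2 w \<alpha>)
  have "\<exists>ss. word ss (rfl \<alpha>)"
    using pos_or_neg[OF 2(2)] word_refl[of \<alpha>] word_refl[of "- \<alpha>"] refl_minus[OF 2(2)] by auto
  with 2 word_append show ?case by blast
qed

lemma word_weyl: "word ss w \<Longrightarrow> w \<in> weyl R"
  unfolding word_def
  by (induction ss arbitrary: w) (auto intro!: weyl.intros simp: simple_root)

lemma len_word: "len R w = (LEAST n. \<exists>ss. length ss = n \<and> word ss w)"
  by (simp add: len_def word_def)

lemma len_le: "word ss w \<Longrightarrow> len R w \<le> length ss"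
  unfolding len_word by (rule Least_le) blast

lemma reduced_word:
  assumes "w \<in> weyl R"
  obtains ss where "word ss w" "length ss = len R w"
proof -
  from word_ex[OF assms] have "\<exists>n ss. length ss = n \<and> word ss w" by blast
  from LeastI_ex[OF this] show ?thesis using that unfolding len_word by blast
qed

lemma len_id [simp]: "len R id = 0"
  using len_le[of "[]" id] by (simp add: word_def)

lemma len_0: "w \<in> weyl R \<Longrightarrow> len R w = 0 \<Longrightarrow> w = id"
  by (erule reduced_word) (simp add: word_def)

lemma len_comp_le:
  assumes "u \<in> weyl R" "w \<in> weyl R"
  shows "len R (u \<circ> w) \<le> len R u + len R w"
proof -
  obtain ss where ss: "word ss u" "length ss = len R u" using reduced_word assms(1) by blast
  obtain ts where ts: "word ts w" "length ts = len R w" using reduced_word assms(2) by blast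
  show ?thesis using len_le[OF word_append[OF ss(1) ts(1)]] ss ts by simp
qed

text \<open>Apply the letters to \<beta> from the right up to the first one that makes it negative.
  A simple reflection does so only to its own root, so multiplying by \<open>rfl \<beta>\<close> on
  the right amounts to deleting this letter.\<close>

lemma strong_exchange:
  assumes "word ss w" "\<beta> \<in> pos R" "w \<beta> \<notin> pos R"
  shows "\<exists>ts. word ts (w \<circ> rfl \<beta>) \<and> length ts < length ss"
  using assms
proof (induction ss arbitrary: w)
  case Nil
  then show ?case by (simp add: word_def)
next
  case (Cons s ss)
  obtain \<alpha> where a: "\<alpha> \<in> simple R" "s = rfl \<alpha>" using Cons(2) by (auto simp: word_def)
  have ar: "\<alpha> \<in> roots R" using a simple_root by auto
  define w' where "w' = foldr (\<circ>) ss id"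
  have w': "word ss w'" and w: "w = rfl \<alpha> \<circ> w'" using Cons(2) a by (auto simp: word_def w'_def)
  have w'W: "w' \<in> weyl R" using w' word_weyl by blast
  have br: "\<beta> \<in> roots R" using Cons pos_root by blast
  show ?case
  proof (cases "w' \<beta> \<in> pos R")
    case False
    from Cons(1)[OF w' Cons(3) this] obtain ts where "word ts (w' \<circ> rfl \<beta>)" "length ts < length ss"
      by blast
    then have "word ([rfl \<alpha>] @ ts) (rfl \<alpha> \<circ> (w' \<circ> rfl \<beta>))" "length ([rfl \<alpha>] @ ts) < length (s # ss)"
      using word_append[OF word_single[OF a(1)]] by auto
    then show ?thesis unfolding w comp_assoc by blast
  next
    case True
    have "w' \<beta> = \<alpha>"
    proof (rule ccontr)
      assume "w' \<beta> \<noteq> \<alpha>"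
      then have "rfl \<alpha> (w' \<beta>) \<in> pos R" using simple_refl_pos a True by blast
      then show False using Cons(4) by (simp add: w)
    qed
    then have "w = w' \<circ> rfl \<beta>" using refl_conj[OF w'W br] by (simp add: w)
    then have "w \<circ> rfl \<beta> = w'" using br by simp
    then show ?thesis using w' by auto
  qed
qed

lemma len_refl_less:
  assumes "w \<in> weyl R" "\<beta> \<in> pos R" "w \<beta> \<notin> pos R"
  shows "len R (w \<circ> rfl \<beta>) < len R w"
proof -
  obtain ss where "word ss w" "length ss = len R w" using reduced_word assms(1) by blast
  with strong_exchange[of ss w \<beta>] assms obtain ts
    where "word ts (w \<circ> rfl \<beta>)" "length ts < len R w" by auto
  then show ?thesis using len_le by fastforce
qed

text \<open>The preceding inequality for \<open>w \<circ> rfl \<beta>\<close>, which makes \<beta>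
  negative.\<close>

lemma len_refl_greater:
  assumes "w \<in> weyl R" "\<beta> \<in> pos R" "w \<beta> \<in> pos R"
  shows "len R w < len R (w \<circ> rfl \<beta>)"
proof -
  have b: "\<beta> \<in> roots R" using assms pos_root by blast
  have "(w \<circ> rfl \<beta>) \<beta> \<notin> pos R"
    using assms not_pos_and_neg by (simp add: refl_self b weyl_minus)
  from len_refl_less[OF weyl_comp[OF assms(1) refl_weyl[OF b]] assms(2) this] b show ?thesis
    by (simp only: comp_refl_refl)
qed

lemma len_simple:
  assumes "\<alpha> \<in> simple R"
  shows "len R (rfl \<alpha>) = 1"
proof -
  have "0 < len R (rfl \<alpha>)"
    using len_refl_greater[OF weyl.intros(1) simple_pos[OF assms]] assms by (simp add: simple_pos)
  moreover have "len R (rfl \<alpha>) \<le> 1" using len_le[OF word_single[OF assms]] by simp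
  ultimately show ?thesis by simp
qed

text \<open>Subadditivity allows a change by at most 1, and the sign of \<open>w \<alpha>\<close>
  decides its direction. The second conclusion guarantees that the subtraction of natural numbers in
  the first is not truncated.\<close>

lemma len_comp_simple:
  assumes "w \<in> weyl R" "\<alpha> \<in> simple R"
  shows "len R (w \<circ> rfl \<alpha>) = (if w \<alpha> \<in> pos R then len R w + 1 else len R w - 1)"
    and "w \<alpha> \<notin> pos R \<Longrightarrow> 0 < len R w"
proof -
  have a: "\<alpha> \<in> roots R" using assms simple_root by auto
  have 1: "len R (w \<circ> rfl \<alpha>) \<le> len R w + 1"
    using len_comp_le[OF assms(1) refl_weyl[OF a]] by (simp add: len_simple assms)
  have 2: "len R w \<le> len R (w \<circ> rfl \<alpha>) + 1"
    using len_comp_le[OF weyl_comp[OF assms(1) refl_weyl[OF a]] refl_weyl[OF a]] a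
    by (simp add: len_simple assms)
  show "len R (w \<circ> rfl \<alpha>) = (if w \<alpha> \<in> pos R then len R w + 1 else len R w - 1)"
    using 1 2 len_refl_greater[OF assms(1) simple_pos[OF assms(2)]]
      len_refl_less[OF assms(1) simple_pos[OF assms(2)]] by auto
  show "0 < len R w" if "w \<alpha> \<notin> pos R"
    using len_refl_less[OF assms(1) simple_pos[OF assms(2)] that] by simp
qed

lemma len_comp_simple_cases:
  assumes "w \<in> weyl R" "\<alpha> \<in> simple R"
  obtains "len R (w \<circ> rfl \<alpha>) = len R w + 1" | "len R w = len R (w \<circ> rfl \<alpha>) + 1"
  using len_comp_simple[OF assms] by (cases "w \<alpha> \<in> pos R") auto

lemma right_descent:
  assumes "w \<in> weyl R" "w \<noteq> id"
  obtains \<alpha> where "\<alpha> \<in> simple R" "len R w = len R (w \<circ> rfl \<alpha>) + 1"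
proof -
  obtain ss where ss: "word ss w" "length ss = len R w" using reduced_word assms by blast
  with assms have "ss \<noteq> []" by (auto simp: word_def)
  then obtain ts s where e: "ss = ts @ [s]" by (metis rev_exhaust)
  then obtain \<alpha> where a: "\<alpha> \<in> simple R" "s = rfl \<alpha>" using ss by (auto simp: word_def)
  have "word ts (foldr (\<circ>) ts id)" using ss e by (auto simp: word_def)
  moreover have "w = foldr (\<circ>) ts id \<circ> rfl \<alpha>"
    using ss e a foldr_comp[of ts s] by (auto simp: word_def)
  ultimately have "word ts (w \<circ> rfl \<alpha>)" using a simple_root by simp
  then have "len R (w \<circ> rfl \<alpha>) < len R w" using len_le ss e by fastforce
  then have "len R w = len R (w \<circ> rfl \<alpha>) + 1"
    by (rule_tac len_comp_simple_cases[OF assms(1) a(1)]) auto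
  with a that show ?thesis by blast
qed

lemma word_rev: "word ss w \<Longrightarrow> word (rev ss) (inv w)"
proof (induction ss arbitrary: w)
  case Nil
  then show ?case by (auto simp: word_def)
next
  case (Cons s ss)
  obtain \<alpha> where a: "\<alpha> \<in> simple R" "s = rfl \<alpha>" using Cons(2) by (auto simp: word_def)
  define w' where "w' = foldr (\<circ>) ss id"
  have w': "word ss w'" and w: "w = rfl \<alpha> \<circ> w'" using Cons(2) a by (auto simp: word_def w'_def)
  have "inv w = inv w' \<circ> rfl \<alpha>"
    using w w' word_weyl a by (simp add: inv_comp_weyl refl_weyl simple_root inv_refl)
  moreover have "word (rev ss @ [rfl \<alpha>]) (inv w' \<circ> rfl \<alpha>)"
    by (intro word_append Cons(1) w' word_single a)
  ultimately show ?case by (simp only: a rev.simps)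
qed

lemma len_inv:
  assumes "w \<in> weyl R"
  shows "len R (inv w) = len R w"
proof -
  have "len R (inv w) \<le> len R w" if W: "w \<in> weyl R" for w
  proof -
    obtain ss where "word ss w" "length ss = len R w" using reduced_word[OF W] .
    then show ?thesis using len_le[OF word_rev] by fastforce
  qed
  from this[OF assms] this[OF inv_weyl[OF assms]] assms show ?thesis by simp
qed

lemma len_simple_comp:
  assumes "w \<in> weyl R" "\<alpha> \<in> simple R"
  shows "len R (rfl \<alpha> \<circ> w) = len R (inv w \<circ> rfl \<alpha>)"
  using len_inv[OF weyl_comp[OF refl_weyl[OF simple_root[OF assms(2)]] assms(1)]] assms
  by (simp add: inv_comp_weyl refl_weyl simple_root inv_refl)

text \<open>Restriction to the roots is injective even if they do not span the lattice: an element
  that fixes every root keeps the simple roots positive, so it has no right descent and is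
  \<open>id\<close>.\<close>

lemma finite_weyl: "finite (weyl R)"
proof -
  let ?f = "\<lambda>w :: 'x \<Rightarrow> 'x. restrict w (roots R)"
  have "inj_on ?f (weyl R)"
  proof (rule inj_onI)
    fix u w assume W: "u \<in> weyl R" "w \<in> weyl R" and e: "?f u = ?f w"
    define g where "g = inv w \<circ> u"
    have g: "g \<in> weyl R" using W weyl_comp inv_weyl g_def by auto
    have "g \<alpha> = \<alpha>" if "\<alpha> \<in> roots R" for \<alpha>
    proof -
      have "?f u \<alpha> = ?f w \<alpha>" by (simp only: e)
      then have "u \<alpha> = w \<alpha>" using that by simp
      then show ?thesis using W by (simp add: g_def bij_weyl bij_is_inj)
    qed
    then have fixed: "g \<alpha> \<in> pos R" if "\<alpha> \<in> simple R" for \<alpha>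
      using that by (simp add: simple_root simple_pos)
    have "g = id"
    proof (rule ccontr)
      assume "g \<noteq> id"
      then obtain \<alpha> where a: "\<alpha> \<in> simple R" "len R g = len R (g \<circ> rfl \<alpha>) + 1"
        using right_descent g by blast
      then show False using len_comp_simple(1)[OF g a(1)] fixed by simp
    qed
    then have "w \<circ> (inv w \<circ> u) = w" by (simp add: g_def)
    then show "u = w" using W by (simp add: comp_assoc[symmetric])
  qed
  moreover have "?f ` weyl R \<subseteq> roots R \<rightarrow>\<^sub>E roots R"
    using weyl_root by auto
  then have "finite (?f ` weyl R)" by (rule finite_subset) (intro finite_PiE finite_roots)
  ultimately show ?thesis using finite_imageD by blast
qed

section \<open>The Bruhat order\<close>

definition bruhat_step :: "(('x \<Rightarrow> 'x) \<times> ('x \<Rightarrow> 'x)) set" where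
  "bruhat_step =
    {(x, x \<circ> rfl \<alpha>) | x \<alpha>. x \<in> weyl R \<and> \<alpha> \<in> roots R \<and> len R x < len R (x \<circ> rfl \<alpha>)}"

lemma bruhat_le_step: "bruhat_le R u v \<longleftrightarrow> (u, v) \<in> bruhat_step\<^sup>*"
  by (simp add: bruhat_le_def bruhat_step_def)

lemma bruhat_refl: "bruhat_le R u u"
  by (simp add: bruhat_le_step)

lemma bruhat_trans: "bruhat_le R u v \<Longrightarrow> bruhat_le R v w \<Longrightarrow> bruhat_le R u w"
  by (simp add: bruhat_le_step)

lemma bruhat_step_len: "(x, y) \<in> bruhat_step \<Longrightarrow> len R x < len R y"
  unfolding bruhat_step_def by blast

lemma bruhat_len: "bruhat_le R u v \<Longrightarrow> u = v \<or> len R u < len R v"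
  unfolding bruhat_le_step by (induction rule: rtrancl_induct) (auto dest: bruhat_step_len)

lemma bruhat_stepI:
  "x \<in> weyl R \<Longrightarrow> \<alpha> \<in> roots R \<Longrightarrow> len R x < len R (x \<circ> rfl \<alpha>) \<Longrightarrow> (x, x \<circ> rfl \<alpha>) \<in> bruhat_step"
  unfolding bruhat_step_def by blast

lemma bruhat_up:
  assumes "x \<in> weyl R" "\<alpha> \<in> roots R" "len R x < len R (x \<circ> rfl \<alpha>)"
  shows "bruhat_le R x (x \<circ> rfl \<alpha>)"
  unfolding bruhat_le_step using assms by (intro r_into_rtrancl bruhat_stepI)

lemma bruhat_down:
  assumes "x \<in> weyl R" "\<alpha> \<in> roots R" "len R (x \<circ> rfl \<alpha>) < len R x"
  shows "bruhat_le R (x \<circ> rfl \<alpha>) x"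
proof -
  have "x \<circ> rfl \<alpha> \<in> weyl R" using assms weyl_comp refl_weyl by blast
  then show ?thesis using bruhat_up[of "x \<circ> rfl \<alpha>" \<alpha>] assms by (simp only: comp_refl_refl)
qed

text \<open>A step is multiplication by a reflection in a positive \<beta> with
  \<open>x \<beta>\<close> positive. If \<beta> is not \<alpha>, then
  \<open>rfl \<alpha> \<beta>\<close> is positive too, and \<open>x \<circ> rfl \<alpha>\<close>
  maps it to \<open>x \<beta>\<close>; so the conjugate reflection raises
  \<open>x \<circ> rfl \<alpha>\<close>.\<close>

lemma bruhat_step_simple:
  assumes "(x, y) \<in> bruhat_step" and a: "\<alpha> \<in> simple R"
  shows "y = x \<circ> rfl \<alpha> \<or> (x \<circ> rfl \<alpha>, y \<circ> rfl \<alpha>) \<in> bruhat_step"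
proof -
  obtain \<beta>' where b': "x \<in> weyl R" "\<beta>' \<in> roots R" "y = x \<circ> rfl \<beta>'" "len R x < len R y"
    using assms(1) by (auto simp: bruhat_step_def)
  obtain \<beta> where b: "\<beta> \<in> pos R" "y = x \<circ> rfl \<beta>"
    using pos_or_neg[OF b'(2)] refl_minus[OF b'(2)] b'(3) by metis
  have ar: "\<alpha> \<in> roots R" and br: "\<beta> \<in> roots R" using a b simple_root pos_root by auto
  show ?thesis
  proof (cases "\<beta> = \<alpha>")
    case True
    then show ?thesis using b by blast
  next
    case False
    have "x \<beta> \<in> pos R" using len_refl_less[OF b'(1) b(1)] b'(4) b(2) by auto
    then have p: "(x \<circ> rfl \<alpha>) (rfl \<alpha> \<beta>) \<in> pos R" using ar by simp
    have w: "x \<circ> rfl \<alpha> \<in> weyl R" using b' ar weyl_comp refl_weyl by blast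
    have s: "rfl \<alpha> \<beta> \<in> pos R" using simple_refl_pos a b False by blast
    have "rfl (rfl \<alpha> \<beta>) \<circ> rfl \<alpha> = rfl \<alpha> \<circ> rfl \<beta>" by (rule refl_conj[OF refl_weyl[OF ar] br])
    then have "rfl \<alpha> \<circ> rfl (rfl \<alpha> \<beta>) \<circ> rfl \<alpha> = rfl \<alpha> \<circ> (rfl \<alpha> \<circ> rfl \<beta>)" by (simp only: comp_assoc)
    then have "rfl \<alpha> \<circ> rfl (rfl \<alpha> \<beta>) \<circ> rfl \<alpha> = rfl \<beta>" by (simp only: refl_refl_comp[OF ar])
    then have "rfl \<alpha> \<circ> rfl (rfl \<alpha> \<beta>) = rfl \<beta> \<circ> rfl \<alpha>" by (metis comp_refl_refl ar)
    then have "x \<circ> rfl \<alpha> \<circ> rfl (rfl \<alpha> \<beta>) = y \<circ> rfl \<alpha>" by (simp only: b(2) comp_assoc)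
    moreover have "(x \<circ> rfl \<alpha>, x \<circ> rfl \<alpha> \<circ> rfl (rfl \<alpha> \<beta>)) \<in> bruhat_step"
      by (rule bruhat_stepI[OF w pos_root[OF s] len_refl_greater[OF w s p]])
    ultimately show ?thesis by (simp only: simp_thms)
  qed
qed

text \<open>Multiply a chain from \<open>u\<close> to \<open>v\<close> by
  \<open>rfl \<alpha>\<close>, starting at the bottom. Each step survives until one is itself
  multiplication by \<open>rfl \<alpha>\<close>; there the original chain takes over.\<close>

lemma bruhat_lift_left:
  assumes "bruhat_le R u v" and a: "\<alpha> \<in> simple R"
  shows "bruhat_le R (u \<circ> rfl \<alpha>) (v \<circ> rfl \<alpha>) \<or> bruhat_le R (u \<circ> rfl \<alpha>) v"
  using assms(1) unfolding bruhat_le_step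
proof (induction rule: converse_rtrancl_induct)
  case base
  then show ?case by blast
next
  case (step x y)
  from bruhat_step_simple[OF step(1) a] show ?case
  proof
    assume "y = x \<circ> rfl \<alpha>"
    with step(2) show ?thesis by blast
  next
    assume "(x \<circ> rfl \<alpha>, y \<circ> rfl \<alpha>) \<in> bruhat_step"
    with step(3) show ?thesis by (blast intro: converse_rtrancl_into_rtrancl)
  qed
qed

text \<open>The mirror image: the chain is now multiplied from the top downwards.\<close>

lemma bruhat_lift_right:
  assumes "bruhat_le R u v" and a: "\<alpha> \<in> simple R"
  shows "bruhat_le R (u \<circ> rfl \<alpha>) (v \<circ> rfl \<alpha>) \<or> bruhat_le R u (v \<circ> rfl \<alpha>)"
  using assms(1) unfolding bruhat_le_step
proof (induction rule: rtrancl_induct)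
  case base
  then show ?case by blast
next
  case (step x y)
  have "(x \<circ> rfl \<alpha>) \<circ> rfl \<alpha> = x" using a simple_root by simp
  with step show ?case using bruhat_step_simple[OF step(2) a]
    by (metis rtrancl.rtrancl_into_rtrancl)
qed

text \<open>Together with its counterpart for ascents this is the lifting property: it keeps an
  interval stable under right multiplication by \<open>rfl \<alpha>\<close> when \<alpha> is an
  ascent of the bottom and a descent of the top.\<close>

lemma bruhat_lift_desc:
  assumes "bruhat_le R u v" "v \<in> weyl R" "\<alpha> \<in> simple R" "len R (v \<circ> rfl \<alpha>) < len R v"
  shows "bruhat_le R (u \<circ> rfl \<alpha>) v"
  using bruhat_lift_left[OF assms(1,3)] bruhat_down[OF assms(2) _ assms(4)] assms(3) simple_root
    bruhat_trans by blast

lemma bruhat_lift_asc: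
  assumes "bruhat_le R u v" "u \<in> weyl R" "\<alpha> \<in> simple R" "len R u < len R (u \<circ> rfl \<alpha>)"
  shows "bruhat_le R u (v \<circ> rfl \<alpha>)"
  using bruhat_lift_right[OF assms(1,3)] bruhat_up[OF assms(2) _ assms(4)] assms(3) simple_root
    bruhat_trans by blast

section \<open>Signed counts of Bruhat intervals\<close>

lemma finite_bruhat_interval: "finite (bruhat_interval R u v)"
  by (simp add: bruhat_interval_def finite_weyl)

lemma bruhat_interval_same:
  assumes "u \<in> weyl R"
  shows "bruhat_interval R u u = {u}"
  using assms bruhat_len bruhat_refl unfolding bruhat_interval_def by (auto dest!: bruhat_len)

text \<open>Right multiplication by a simple reflection that is an ascent of \<open>u\<close> and a descent of \<open>v\<close> is a
  sign-reversing involution of the interval.\<close>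

lemma interval_sum_asc:
  assumes u: "u \<in> weyl R" and v: "v \<in> weyl R" and a: "\<alpha> \<in> simple R"
    and ua: "len R u < len R (u \<circ> rfl \<alpha>)" and va: "len R (v \<circ> rfl \<alpha>) < len R v"
  shows "(\<Sum>x\<in>bruhat_interval R u v. (- 1) ^ len R x :: int) = 0"
proof -
  let ?I = "bruhat_interval R u v"
  have ar: "\<alpha> \<in> roots R" using a simple_root by blast
  have closed: "x \<circ> rfl \<alpha> \<in> ?I" if "x \<in> ?I" for x
    using that bruhat_lift_desc[OF _ v a va] bruhat_lift_asc[OF _ u a ua] ar weyl_comp refl_weyl
    unfolding bruhat_interval_def by blast
  have sign: "(- 1) ^ len R (x \<circ> rfl \<alpha>) = - ((- 1) ^ len R x :: int)" if "x \<in> ?I" for x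
    using that by (rule_tac len_comp_simple_cases[of x \<alpha>]) (auto simp: a bruhat_interval_def)
  have "(\<Sum>x\<in>?I. (- 1) ^ len R x :: int) = (\<Sum>x\<in>?I. - ((- 1) ^ len R x))"
    by (rule sum.reindex_bij_witness[of _ "\<lambda>x. x \<circ> rfl \<alpha>" "\<lambda>x. x \<circ> rfl \<alpha>"])
       (auto simp only: comp_refl_refl[OF ar] closed sign)
  then show ?thesis by (simp add: sum_negf)
qed

text \<open>Verma's theorem: the Moebius function of the Bruhat order is \<open>(- 1) ^ (len u + len v)\<close>.\<close>

lemma interval_sum_zero:
  assumes "u \<in> weyl R" "v \<in> weyl R" "u \<noteq> v"
  shows "(\<Sum>x\<in>bruhat_interval R u v. (- 1) ^ len R x :: int) = 0"
  using assms
proof (induction "len R v" arbitrary: u v rule: less_induct)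
  case less
  note u = less(2) and v = less(3) and ne = less(4)
  let ?S = "\<lambda>A. \<Sum>x\<in>A. (- 1) ^ len R x :: int"
  show ?case
  proof (cases "bruhat_le R u v")
    case False
    then have "bruhat_interval R u v = {}" unfolding bruhat_interval_def using bruhat_trans by blast
    then show ?thesis by simp
  next
    case uv: True
    then have "v \<noteq> id" using bruhat_len[OF uv] ne by auto
    then obtain \<alpha> where a: "\<alpha> \<in> simple R" and va: "len R v = len R (v \<circ> rfl \<alpha>) + 1"
      using right_descent v by blast
    have ar: "\<alpha> \<in> roots R" using a simple_root by blast
    let ?u = "u \<circ> rfl \<alpha>" and ?v = "v \<circ> rfl \<alpha>"
    have us: "?u \<in> weyl R" "?v \<in> weyl R" using u v ar weyl_comp refl_weyl by auto
    have uu: "?u \<circ> rfl \<alpha> = u" and vv: "?v \<circ> rfl \<alpha> = v" using ar by auto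
    show ?thesis
    proof (cases "len R u < len R ?u")
      case True
      then show ?thesis using interval_sum_asc[OF u v a] va by simp
    next
      case False
      then have lu: "len R u = len R ?u + 1" using len_comp_simple_cases[OF u a] by force
      have ulow: "bruhat_le R ?u u" using bruhat_down[OF u ar] lu by simp
      have ulv: "bruhat_le R ?u v" using bruhat_trans[OF ulow uv] .
      have s1: "?S (bruhat_interval R ?u v) = 0"
        using interval_sum_asc[OF us(1) v a] lu va by (simp only: uu)
      have "?u \<noteq> ?v" using ne uu vv by metis
      then have s2: "?S (bruhat_interval R ?u ?v) = 0" using less(1)[OF _ us] va by simp
      \<comment> \<open>\<alpha> is a descent of \<open>u\<close> but an ascent of
        \<open>?v\<close>.\<close>
      have "u \<noteq> ?v" using va lu vv by force
      then have s3: "?S (bruhat_interval R u ?v) = 0" using less(1)[OF _ u us(2)] va by simp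
      have vlow: "bruhat_le R ?v v" using bruhat_down[OF v ar] va by simp
      have sub1: "bruhat_interval R u v \<subseteq> bruhat_interval R ?u v"
        and sub2: "bruhat_interval R u ?v \<subseteq> bruhat_interval R ?u ?v"
        unfolding bruhat_interval_def using ulow bruhat_trans by blast+
      \<comment> \<open>Lowering the bottom from \<open>u\<close> to \<open>?u\<close> adds the same
        elements below \<open>v\<close> as below \<open>?v\<close>: an added \<open>x\<close> cannot
        have \<alpha> as a descent, or \<open>?u \<le> x\<close> would lift to
        \<open>u \<le> x\<close>, and as \<alpha> is an ascent of \<open>x\<close>,
        \<open>x \<le> v\<close> lifts to \<open>x \<le> ?v\<close>. So the sum in question is
        determined by three sums that vanish.\<close>
      have "bruhat_interval R ?u v - bruhat_interval R u v =
          bruhat_interval R ?u ?v - bruhat_interval R u ?v" (is "?L = ?R")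
      proof
        show "?R \<subseteq> ?L" unfolding bruhat_interval_def using vlow bruhat_trans by blast
        show "?L \<subseteq> ?R"
        proof
          fix x assume "x \<in> ?L"
          then have x: "x \<in> weyl R" "bruhat_le R ?u x" "bruhat_le R x v" "\<not> bruhat_le R u x"
            unfolding bruhat_interval_def by auto
          have "\<not> len R (x \<circ> rfl \<alpha>) < len R x"
            using bruhat_lift_desc[OF x(2,1) a] x(4) uu by auto
          then have "len R x < len R (x \<circ> rfl \<alpha>)" using len_comp_simple_cases[OF x(1) a] by force
          then have "bruhat_le R x ?v" using bruhat_lift_asc[OF x(3,1) a] by blast
          then show "x \<in> ?R" using x unfolding bruhat_interval_def by blast
        qed
      qed
      then have "?S (bruhat_interval R ?u v) - ?S (bruhat_interval R u v) =
          ?S (bruhat_interval R ?u ?v) - ?S (bruhat_interval R u ?v)"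
        using sum_diff[OF finite_bruhat_interval sub1, of "\<lambda>x. (- 1) ^ len R x :: int"]
          sum_diff[OF finite_bruhat_interval sub2, of "\<lambda>x. (- 1) ^ len R x :: int"] by simp
      with s1 s2 s3 show ?thesis by simp
    qed
  qed
qed

end

section \<open>The substitution of the inverse of q for q\<close>

lemma emb_add: "emb (a + b) = emb a + emb b"
  by (simp add: emb_def)

lemma emb_mult: "emb (a * b) = emb a * emb b"
  by (simp add: emb_def)

lemma emb_0 [simp]: "emb 0 = 0"
  by (simp add: emb_def Zero_fract_def)

lemma emb_1 [simp]: "emb 1 = 1"
  by (simp add: emb_def One_fract_def)

lemma emb_eq_0_iff [simp]: "emb a = 0 \<longleftrightarrow> a = 0"
  by (simp add: emb_def Zero_fract_def eq_fract)

lemma Fract_emb: "b \<noteq> 0 \<Longrightarrow> Fraction_Field.Fract a b = emb a / emb b"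
  by (simp add: emb_def)

lemma const_add: "const (a + b) = const a + const b"
  unfolding const_def by (simp flip: emb_add)

lemma const_mult: "const (a * b) = const a * const b"
  unfolding const_def emb_mult[symmetric] by (simp add: mult.commute)

lemma const_eq_0_iff [simp]: "const a = 0 \<longleftrightarrow> a = 0"
  by (simp add: const_def)

lemma const_0 [simp]: "const 0 = 0"
  by simp

lemma const_1 [simp]: "const 1 = 1"
  unfolding const_def by (metis emb_1 one_pCons)

lemma qvar_nonzero [simp]: "qvar \<noteq> 0"
  by (simp add: qvar_def)

section \<open>Extending homomorphisms to the fraction field\<close>

context
  fixes \<phi> :: "'a::idom \<Rightarrow> 'b::field"
  assumes add: "\<And>a b. \<phi> (a + b) = \<phi> a + \<phi> b"
    and mult: "\<And>a b. \<phi> (a * b) = \<phi> a * \<phi> b"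
    and inj: "\<And>a. \<phi> a = 0 \<Longrightarrow> a = 0"
begin

text \<open>Equal fractions have equal cross products, and so do their images; injectivity keeps the
  denominators of the images nonzero.\<close>

lemma fract_ext_Fract:
  assumes "b \<noteq> 0"
  shows "fract_ext \<phi> (Fraction_Field.Fract a b) = \<phi> a / \<phi> b"
  unfolding fract_ext_def
proof (rule the_equality)
  show "\<exists>a' b'. b' \<noteq> 0 \<and> Fraction_Field.Fract a b = Fraction_Field.Fract a' b' \<and> \<phi> a / \<phi> b = \<phi> a' / \<phi> b'"
    using assms by blast
next
  fix y
  assume "\<exists>a' b'. b' \<noteq> 0 \<and> Fraction_Field.Fract a b = Fraction_Field.Fract a' b' \<and> y = \<phi> a' / \<phi> b'"
  then obtain a' b' where b': "b' \<noteq> 0" and e: "Fraction_Field.Fract a b = Fraction_Field.Fract a' b'"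
    and y: "y = \<phi> a' / \<phi> b'" by blast
  from e assms b' have "a * b' = a' * b" by (simp add: eq_fract)
  then have "\<phi> a * \<phi> b' = \<phi> a' * \<phi> b" by (simp flip: mult)
  moreover have "\<phi> b \<noteq> 0" "\<phi> b' \<noteq> 0" using inj assms b' by auto
  ultimately show "y = \<phi> a / \<phi> b" by (simp add: y frac_eq_eq)
qed

lemma fract_ext_add: "fract_ext \<phi> (x + y) = fract_ext \<phi> x + fract_ext \<phi> y"
proof (cases x, cases y)
  fix a b c d :: 'a
  assume *: "x = Fraction_Field.Fract a b" "b \<noteq> 0" "y = Fraction_Field.Fract c d" "d \<noteq> 0"
  moreover have "\<phi> b \<noteq> 0" "\<phi> d \<noteq> 0" using inj * by auto
  ultimately show ?thesis by (simp add: fract_ext_Fract add mult add_frac_eq)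
qed

lemma fract_ext_mult: "fract_ext \<phi> (x * y) = fract_ext \<phi> x * fract_ext \<phi> y"
  by (cases x, cases y) (simp add: fract_ext_Fract mult)

end

text \<open>The point is a parameter because two values matter: the inverse of \<open>qvar\<close>
  gives \<open>bar\<close>, and \<open>qvar\<close> gives the embedding \<open>emb\<close>.\<close>

definition eval_at :: "'x::linordered_ab_group_add ratfun \<Rightarrow> 'x torus_rat poly \<Rightarrow> 'x ratfun" where
  "eval_at y p = poly (map_poly const p) y"

lemma eval_at_0 [simp]: "eval_at y 0 = 0"
  by (simp add: eval_at_def)

lemma eval_at_pCons: "eval_at y (pCons a p) = const a + y * eval_at y p"
  by (cases "p = 0 \<and> a = 0") (auto simp: eval_at_def map_poly_pCons)

lemma eval_at_1 [simp]: "eval_at y 1 = 1"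
  by (simp add: one_pCons eval_at_pCons)

lemma eval_at_add: "eval_at y (p + q) = eval_at y p + eval_at y q"
  by (induction p q rule: poly_induct2) (simp_all add: eval_at_pCons const_add algebra_simps)

lemma eval_at_smult: "eval_at y (smult c p) = const c * eval_at y p"
  by (induction p) (simp_all add: eval_at_pCons const_mult algebra_simps)

lemma eval_at_mult: "eval_at y (p * q) = eval_at y p * eval_at y q"
  by (induction p) (simp_all add: eval_at_pCons eval_at_add eval_at_smult algebra_simps)

lemma eval_at_qvar: "eval_at qvar p = emb p"
proof (induction p)
  case (pCons a p)
  have "pCons a p = [:a:] + [:0, 1:] * p" by simp
  then have "emb (pCons a p) = const a + qvar * emb p"
    by (simp only: emb_add emb_mult const_def qvar_def)
  with pCons show ?case by (simp add: eval_at_pCons)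
qed simp

text \<open>Reversing the coefficients turns a zero at the inverse of q into a zero at q, and
  evaluation at q is the injective map \<open>emb\<close>.\<close>

lemma eval_at_inverse_qvar_inj:
  assumes "eval_at (inverse qvar) p = 0"
  shows "p = 0"
proof -
  \<comment> \<open>Reversal depends on the degree, so it commutes with
    \<open>map_poly const\<close> only because \<open>const\<close> keeps the leading coefficient
    nonzero.\<close>
  have "degree (map_poly const p) = degree p"
    by (cases "p = 0") (auto intro: map_poly_degree_eq)
  then have "map_poly const (reflect_poly p) = reflect_poly (map_poly const p)"
    by (intro poly_eqI) (simp add: coeff_reflect_poly coeff_map_poly)
  then have "emb (reflect_poly p) = poly (reflect_poly (map_poly const p)) qvar"
    by (simp flip: eval_at_qvar) (simp add: eval_at_def)
  also have "\<dots> = 0" using assms by (simp add: poly_reflect_poly_nz eval_at_def)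
  finally show ?thesis by simp
qed

lemma bar_fract_ext: "bar = fract_ext (eval_at (inverse qvar))"
  by (simp add: bar_def eval_at_def[abs_def])

lemma bar_add: "bar (x + y) = bar x + bar y"
  unfolding bar_fract_ext
  by (rule fract_ext_add) (auto simp: eval_at_add eval_at_mult dest: eval_at_inverse_qvar_inj)

lemma bar_mult: "bar (x * y) = bar x * bar y"
  unfolding bar_fract_ext
  by (rule fract_ext_mult) (auto simp: eval_at_add eval_at_mult dest: eval_at_inverse_qvar_inj)

lemma bar_Fract:
  "b \<noteq> 0 \<Longrightarrow> bar (Fraction_Field.Fract a b) = eval_at (inverse qvar) a / eval_at (inverse qvar) b"
  unfolding bar_fract_ext
  by (rule fract_ext_Fract) (auto simp: eval_at_add eval_at_mult dest: eval_at_inverse_qvar_inj)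

lemma bar_emb: "bar (emb p) = eval_at (inverse qvar) p"
  by (simp add: emb_def bar_Fract)

lemma bar_0 [simp]: "bar 0 = 0"
  using bar_emb[of 0] by simp

lemma bar_sum: "bar (sum f A) = (\<Sum>x\<in>A. bar (f x))"
  by (induction A rule: infinite_finite_induct) (simp_all add: bar_add)

lemma bar_const: "bar (const c) = const c"
  using bar_emb[of "[:c:]"] by (simp add: const_def[symmetric] eval_at_pCons)

lemma bar_inverse_qvar: "bar (inverse qvar) = qvar"
  unfolding qvar_def emb_def inverse_fract
  by (simp add: bar_Fract eval_at_pCons) (simp add: qvar_def emb_def One_fract_def)

lemma bar_eval_at: "bar (eval_at y p) = eval_at (bar y) p"
  by (induction p) (simp_all add: eval_at_pCons bar_add bar_mult bar_const)

text \<open>Applied twice to a polynomial, \<open>bar\<close> evaluates it at q, which is the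
  embedding; multiplicativity extends this to fractions.\<close>

lemma bar_bar [simp]: "bar (bar x) = x"
proof (cases x)
  case (Fract a b)
  have emb: "bar (bar (emb p)) = emb p" for p :: "'a torus_rat poly"
    by (simp add: bar_emb bar_eval_at bar_inverse_qvar eval_at_qvar)
  have "x * emb b = emb a" using Fract by (simp add: Fract_emb)
  then have "bar (bar (x * emb b)) = bar (bar (emb a))" by simp
  then have "bar (bar x) * emb b = emb a" by (simp only: bar_mult emb)
  with \<open>x * emb b = emb a\<close> have "bar (bar x) * emb b = x * emb b" by simp
  with Fract show ?thesis by simp
qed

text \<open>However 0 is written as a fraction, its numerator is 0, so the description has a unique
  value here. Hence a substitution cannot enlarge the support of an element of the Hecke
  algebra.\<close>

lemma subst_0 [simp]: "subst w 0 = 0"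
  unfolding subst_def fract_ext_def
proof (rule the_equality)
  show "\<exists>a b. b \<noteq> 0 \<and> 0 = Fraction_Field.Fract a b \<and>
      0 = emb (map_poly (subst_rat w) a) / emb (map_poly (subst_rat w) b)"
    by (rule exI[of _ 0], rule exI[of _ 1]) (simp flip: Zero_fract_def)
next
  fix y
  assume "\<exists>a b. b \<noteq> 0 \<and> 0 = Fraction_Field.Fract a b \<and>
      y = emb (map_poly (subst_rat w) a) / emb (map_poly (subst_rat w) b)"
  then obtain a b where *: "b \<noteq> 0" "0 = Fraction_Field.Fract a b"
    "y = emb (map_poly (subst_rat w) a) / emb (map_poly (subst_rat w) b)" by blast
  then have "a = 0" by (simp add: Fract_emb)
  with * show "y = 0" by simp
qed

section \<open>The Hecke algebra\<close>

locale weyl_hecke = based_root_datum R + hecke_algebra scale R T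
  for R :: "('x::linordered_ab_group_add, 'm) root_datum_scheme"
    and scale :: "'x ratfun \<Rightarrow> 'h::ring_1 \<Rightarrow> 'h"
    and T :: "('x \<Rightarrow> 'x) \<Rightarrow> 'h"
begin

abbreviation "cf \<equiv> T_coeff scale R T"

lemma T_expand: "h = (\<Sum>x\<in>weyl R. scale (cf h x) (T x))"
proof -
  have "h = (\<Sum>b\<in>T ` weyl R. scale (representation (T ` weyl R) h b) b)"
    by (rule sum_representation_eq[symmetric]) (auto simp: T_independent T_span finite_weyl)
  also have "\<dots> = (\<Sum>x\<in>weyl R. scale (cf h x) (T x))"
    by (simp add: sum.reindex[OF T_inj] T_coeff_def)
  finally show ?thesis .
qed

lemma T_coeff_add: "cf (g + h) x = cf g x + cf h x"
  by (simp add: T_coeff_def representation_add T_independent T_span)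

lemma T_coeff_scale: "cf (scale c h) x = c * cf h x"
  by (simp add: T_coeff_def representation_scale T_independent T_span)

lemma T_coeff_sum: "cf (sum f A) x = (\<Sum>i\<in>A. cf (f i) x)"
  by (simp add: T_coeff_def representation_sum T_independent T_span)

lemma T_coeff_T: "x \<in> weyl R \<Longrightarrow> y \<in> weyl R \<Longrightarrow> cf (T x) y = (if y = x then 1 else 0)"
  using T_inj by (auto simp: T_coeff_def representation_basis T_independent dest: inj_onD)

lemma T_coeff_hecke_subst:
  "x \<in> weyl R \<Longrightarrow> cf (hecke_subst scale R T w h) x = subst w (cf h x)"
  by (simp add: hecke_subst_def T_coeff_sum T_coeff_scale T_coeff_T finite_weyl if_distrib cong: if_cong)

lemma Lambda_coeff: "Lambda scale R T h = cf h id"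
proof -
  interpret L: vector_space_pair scale "(*)"
    by unfold_locales (simp_all add: algebra_simps)
  interpret lin: Vector_Spaces.linear scale "(*)" "Lambda scale R T"
    unfolding Lambda_def by (rule L.linear_construct[OF T_independent])
  have base: "Lambda scale R T (T x) = (if x = id then 1 else 0)" if "x \<in> weyl R" for x
    unfolding Lambda_def using that weyl.intros(1)[of R] T_inj
    by (subst L.construct_basis[OF T_independent]) (auto dest: inj_onD)
  have "Lambda scale R T h = Lambda scale R T (\<Sum>x\<in>weyl R. scale (cf h x) (T x))"
    by (simp flip: T_expand)
  also have "\<dots> = (\<Sum>x\<in>weyl R. cf h x * (if x = id then 1 else 0))"
    by (simp add: lin.sum lin.scale base)
  also have "\<dots> = cf h id"
    using weyl.intros(1)[of R] by (simp add: finite_weyl if_distrib cong: if_cong)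
  finally show ?thesis .
qed

lemma mult_expand: "g * h = (\<Sum>x\<in>weyl R. scale (cf h x) (g * T x))"
proof -
  have "g * h = g * (\<Sum>x\<in>weyl R. scale (cf h x) (T x))" by (simp flip: T_expand)
  then show ?thesis by (simp add: sum_distrib_left scale_mult_right)
qed

text \<open>Lengths add in products with \<open>id\<close>, so left multiplication by
  \<open>T id\<close> fixes every basis vector, and therefore also the expansion of 1.\<close>

lemma T_id: "T id = 1"
proof -
  have id: "id \<in> weyl R" by (rule weyl.intros)
  have "T id * 1 = (\<Sum>x\<in>weyl R. scale (cf 1 x) (T id * T x))" by (rule mult_expand)
  also have "\<dots> = (\<Sum>x\<in>weyl R. scale (cf 1 x) (T x))"
    using T_mult[OF id] by (intro sum.cong) auto
  also have "\<dots> = 1" by (rule T_expand[symmetric])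
  finally show ?thesis by simp
qed

lemma len_simple_comp_cases:
  assumes "w \<in> weyl R" "\<alpha> \<in> simple R"
  obtains "len R (rfl \<alpha> \<circ> w) = len R w + 1" | "len R w = len R (rfl \<alpha> \<circ> w) + 1"
  using len_comp_simple_cases[OF inv_weyl[OF assms(1)] assms(2)] len_simple_comp[OF assms]
    len_inv[OF assms(1)] by metis

lemma T_simple_mult_up:
  assumes "\<alpha> \<in> simple R" "y \<in> weyl R" "len R (rfl \<alpha> \<circ> y) = len R y + 1"
  shows "T (rfl \<alpha>) * T y = T (rfl \<alpha> \<circ> y)"
  using assms T_mult[OF refl_weyl[OF simple_root[OF assms(1)]] assms(2)] by (simp add: len_simple)

lemma T_simple_mult_down:
  assumes a: "\<alpha> \<in> simple R" and y: "y \<in> weyl R" and l: "len R y = len R (rfl \<alpha> \<circ> y) + 1"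
  shows "T (rfl \<alpha>) * T y = scale (qvar - 1) (T y) + scale qvar (T (rfl \<alpha> \<circ> y))"
proof -
  have ar: "\<alpha> \<in> roots R" using a simple_root by blast
  have w: "rfl \<alpha> \<circ> y \<in> weyl R" using ar y weyl_comp refl_weyl by blast
  have "T (rfl \<alpha>) * T (rfl \<alpha> \<circ> y) = T y"
    using T_simple_mult_up[OF a w] l by (simp only: refl_refl_comp[OF ar])
  then have "T (rfl \<alpha>) * T y = T (rfl \<alpha>) * T (rfl \<alpha>) * T (rfl \<alpha> \<circ> y)" by (simp only: mult.assoc)
  also have "\<dots> = scale (qvar - 1) (T (rfl \<alpha>) * T (rfl \<alpha> \<circ> y)) + scale qvar (T (rfl \<alpha> \<circ> y))"
    by (simp add: T_quadratic[OF a] distrib_right scale_mult_left)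
  finally show ?thesis by (simp only: \<open>T (rfl \<alpha>) * T (rfl \<alpha> \<circ> y) = T y\<close>)
qed

text \<open>The last simple factor of \<open>x\<close> moves over to \<open>y\<close>, which leaves
  \<open>x \<circ> y\<close> unchanged. If it shortens \<open>y\<close>, the quadratic relation
  yields the factor q together with a term that contributes nothing.\<close>

lemma T_coeff_T_T:
  assumes "x \<in> weyl R" "y \<in> weyl R"
  shows "cf (T x * T y) id = (if x \<circ> y = id then q_pow R x else 0)"
  using assms
proof (induction "len R x" arbitrary: x y)
  case 0
  then have "x = id" using len_0 by simp
  moreover have "y \<in> weyl R" by (rule 0)
  ultimately show "cf (T x * T y) id = (if x \<circ> y = id then q_pow R x else 0)"
    by (auto simp: T_id q_pow_def T_coeff_T weyl.intros(1))
next
  case (Suc n)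
  have "x \<noteq> id" using Suc(2) by auto
  then obtain \<alpha> where a: "\<alpha> \<in> simple R" and lx: "len R x = len R (x \<circ> rfl \<alpha>) + 1"
    using right_descent Suc(3) by blast
  have ar: "\<alpha> \<in> roots R" using a simple_root by blast
  let ?x = "x \<circ> rfl \<alpha>" and ?y = "rfl \<alpha> \<circ> y"
  have w: "?x \<in> weyl R" "?y \<in> weyl R" using Suc ar weyl_comp refl_weyl by auto
  have n: "n = len R ?x" using Suc(2) lx by simp
  have Tx: "T x = T ?x * T (rfl \<alpha>)"
    using T_mult[OF w(1) refl_weyl[OF ar]] lx by (simp only: comp_refl_refl[OF ar] len_simple[OF a])
  have xy: "?x \<circ> ?y = x \<circ> y" using ar by (simp only: comp_assoc refl_refl_comp)
  have inv: "x = inv y" if "x \<circ> y = id" "x \<in> weyl R" for x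
  proof -
    have "x = x \<circ> y \<circ> inv y" using Suc(4) by (simp add: comp_assoc)
    with that show ?thesis by simp
  qed
  have lxy: "len R x = len R y" "len R ?x = len R ?y" if "x \<circ> y = id"
    using inv[OF that Suc(3)] len_inv[OF Suc(4)] len_simple_comp[OF Suc(4) a] by auto
  show ?case
  proof (rule len_simple_comp_cases[OF Suc(4) a])
    assume up: "len R ?y = len R y + 1"
    \<comment> \<open>Inverse elements have equal lengths, before and after the move, but here
      \<open>x\<close> gets shorter and \<open>y\<close> longer.\<close>
    then have "x \<circ> y \<noteq> id" using lxy lx by auto
    moreover have "T x * T y = T ?x * T ?y" by (simp only: Tx mult.assoc T_simple_mult_up[OF a Suc(4) up])
    ultimately show ?thesis using Suc(1)[OF n w] by (simp only: xy if_False)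
  next
    assume down: "len R y = len R ?y + 1"
    \<comment> \<open>This removes the term with q - 1: if \<open>?x\<close> were inverse to
      \<open>y\<close>, then \<open>x\<close> would be inverse to \<open>?y\<close>, making
      \<open>x\<close> shorter than \<open>?x\<close>.\<close>
    have ne: "?x \<circ> y \<noteq> id"
    proof
      assume e: "?x \<circ> y = id"
      then have "x = inv y \<circ> rfl \<alpha>" using inv[OF e w(1)] ar by (metis comp_refl_refl)
      then have "len R x = len R ?y" using len_simple_comp[OF Suc(4) a] by simp
      moreover have "len R ?x = len R y" using inv[OF e w(1)] len_inv[OF Suc(4)] by simp
      ultimately show False using lx down by simp
    qed
    have "T x * T y = scale (qvar - 1) (T ?x * T y) + scale qvar (T ?x * T ?y)"
      by (simp only: Tx mult.assoc T_simple_mult_down[OF a Suc(4) down] distrib_left scale_mult_right)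
    then have "cf (T x * T y) id =
        (qvar - 1) * cf (T ?x * T y) id + qvar * cf (T ?x * T ?y) id"
      by (simp only: T_coeff_add T_coeff_scale)
    also have "\<dots> = qvar * (if x \<circ> y = id then q_pow R ?x else 0)"
      using Suc(1)[OF n w(1) Suc(4)] Suc(1)[OF n w] ne by (simp only: xy if_False) simp
    also have "qvar * q_pow R ?x = q_pow R x" by (simp only: q_pow_def lx) simp
    then have "qvar * (if x \<circ> y = id then q_pow R ?x else 0) = (if x \<circ> y = id then q_pow R x else 0)"
      by auto
    finally show ?thesis .
  qed
qed

lemma T_coeff_T_mult:
  assumes x: "x \<in> weyl R"
  shows "cf (T x * h) id = q_pow R x * cf h (inv x)"
proof -
  have *: "x \<circ> y = id \<longleftrightarrow> y = inv x" if "y \<in> weyl R" for y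
  proof
    assume e: "x \<circ> y = id"
    have "y = inv x \<circ> x \<circ> y" using x by simp
    with e show "y = inv x" by (simp only: comp_assoc comp_id)
  qed (use x in simp)
  have "cf (T x * h) id = (\<Sum>y\<in>weyl R. cf h y * cf (T x * T y) id)"
    by (subst mult_expand) (simp only: T_coeff_sum T_coeff_scale)
  also have "\<dots> = (\<Sum>y\<in>weyl R. if y = inv x then q_pow R x * cf h (inv x) else 0)"
    by (rule sum.cong) (simp_all add: T_coeff_T_T x * mult.commute)
  also have "\<dots> = q_pow R x * cf h (inv x)" by (simp add: finite_weyl inv_weyl x)
  finally show ?thesis .
qed

text \<open>\<open>T (rfl \<alpha>) * T y\<close> lies in the span of \<open>T y\<close> and
  \<open>T (rfl \<alpha> \<circ> y)\<close>, which bounds the growth of supports.\<close>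

lemma T_coeff_T_simple_mult:
  assumes a: "\<alpha> \<in> simple R" and w: "w \<in> weyl R" and nz: "cf (T (rfl \<alpha>) * h) w \<noteq> 0"
  shows "cf h w \<noteq> 0 \<or> cf h (rfl \<alpha> \<circ> w) \<noteq> 0"
proof -
  have ar: "\<alpha> \<in> roots R" using a simple_root by blast
  have "cf (T (rfl \<alpha>) * h) w = (\<Sum>y\<in>weyl R. cf h y * cf (T (rfl \<alpha>) * T y) w)"
    by (subst mult_expand) (simp only: T_coeff_sum T_coeff_scale)
  then obtain y where y: "y \<in> weyl R" "cf h y \<noteq> 0" "cf (T (rfl \<alpha>) * T y) w \<noteq> 0"
    using nz by (metis (no_types, lifting) mult_zero_left mult_zero_right sum.neutral)
  have sy: "rfl \<alpha> \<circ> y \<in> weyl R" using y ar weyl_comp refl_weyl by blast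
  have "w = y \<or> w = rfl \<alpha> \<circ> y"
    using y(3) T_simple_mult_up[OF a y(1)] T_simple_mult_down[OF a y(1)]
    by (rule_tac len_simple_comp_cases[OF y(1) a])
       (auto simp: T_coeff_add T_coeff_scale T_coeff_T w y(1) sy split: if_splits)
  then show ?thesis using y(2) ar by auto
qed

end

section \<open>The support of \<mu> and the two formulas\<close>

locale weyl_mu = based_root_datum R + mu_family scale R T \<mu>
  for R :: "('x::linordered_ab_group_add, 'm) root_datum_scheme"
    and scale :: "'x ratfun \<Rightarrow> 'h::ring_1 \<Rightarrow> 'h"
    and T \<mu> :: "('x \<Rightarrow> 'x) \<Rightarrow> 'h"
begin

sublocale weyl_hecke R scale T ..

text \<open>Splitting a right descent off \<open>v\<close> puts \<open>\<mu> (rfl \<alpha>)\<close>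
  on the left of the other factor. The support thus grows only by left multiplication with
  \<open>rfl \<alpha>\<close>, which is right multiplication on inverses, and
  \<open>bruhat_lift_left\<close> applies.\<close>

lemma mu_support:
  assumes "v \<in> weyl R" "w \<in> weyl R" "cf (\<mu> v) w \<noteq> 0"
  shows "bruhat_le R (inv w) v"
  using assms
proof (induction "len R v" arbitrary: v w)
  case 0
  then have "v = id" using len_0 by simp
  moreover have "cf (\<mu> v) w \<noteq> 0" and w: "w \<in> weyl R" by (rule 0)+
  ultimately have "cf (T id) w \<noteq> 0" by (simp add: mu_one T_id)
  then have "w = id" using T_coeff_T[OF weyl.intros(1) w] by (auto split: if_splits)
  with \<open>v = id\<close> show ?case by (simp add: bruhat_refl)
next
  case (Suc n)
  have "v \<noteq> id" using Suc(2) by auto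
  then obtain \<alpha> where a: "\<alpha> \<in> simple R" and lv: "len R v = len R (v \<circ> rfl \<alpha>) + 1"
    using right_descent Suc(3) by blast
  have ar: "\<alpha> \<in> roots R" using a simple_root by blast
  let ?v = "v \<circ> rfl \<alpha>" and ?w = "rfl \<alpha> \<circ> w"
  have w: "?v \<in> weyl R" "?w \<in> weyl R" using Suc ar weyl_comp refl_weyl by auto
  have n: "n = len R ?v" using Suc(2) lv by simp
  have vlow: "bruhat_le R ?v v" using bruhat_down[OF Suc(3) ar] lv by simp
  define h where "h = hecke_subst scale R T (rfl \<alpha>) (\<mu> ?v)"
  have ih: "bruhat_le R (inv x) ?v" if "x \<in> weyl R" "cf h x \<noteq> 0" for x
  proof (rule Suc(1)[OF n w(1) that(1)])
    show "cf (\<mu> ?v) x \<noteq> 0" using that by (auto simp: h_def T_coeff_hecke_subst)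
  qed
  have "\<mu> v = \<mu> (rfl \<alpha>) * h"
    using mu_mult[OF w(1) refl_weyl[OF ar]] lv
    by (simp only: comp_refl_refl[OF ar] len_simple[OF a] h_def)
  then have "cf (\<mu> v) w = inverse qvar * cf (T (rfl \<alpha>) * h) w +
      (1 - inverse qvar) * (zpow \<alpha> / (1 - zpow \<alpha>)) * cf h w"
    by (simp only: mu_simple[OF a] distrib_right scale_mult_left T_coeff_add T_coeff_scale mult_1_left)
  then have "cf (T (rfl \<alpha>) * h) w \<noteq> 0 \<or> cf h w \<noteq> 0" using Suc(5) by auto
  then have "cf h w \<noteq> 0 \<or> cf h ?w \<noteq> 0" using T_coeff_T_simple_mult[OF a Suc(4)] by blast
  then show ?case
  proof
    assume "cf h w \<noteq> 0"
    then show ?thesis using ih[OF Suc(4)] vlow bruhat_trans by blast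
  next
    assume "cf h ?w \<noteq> 0"
    then have "bruhat_le R (inv ?w) ?v" using ih w(2) by blast
    moreover have "inv ?w \<circ> rfl \<alpha> = inv w"
      using ar Suc(4) by (simp only: inv_comp_weyl[OF refl_weyl[OF ar] Suc(4)] inv_refl comp_refl_refl)
    ultimately have "bruhat_le R (inv w) v \<or> bruhat_le R (inv w) ?v"
      using bruhat_lift_left[of "inv ?w" ?v \<alpha>] a by (simp only: comp_refl_refl[OF ar])
    then show ?thesis using vlow bruhat_trans by blast
  qed
qed

abbreviation "r \<equiv> r_fun scale R T \<mu>"
abbreviation "m \<equiv> m_fun scale R T \<mu>"

text \<open>The factor \<open>q_pow R x\<close> that arises from pairing with \<open>T x\<close> is
  the one by which \<open>r_fun\<close> normalises the coefficient at \<open>inv x\<close>.\<close>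

lemma m_fun_eq_sum:
  assumes v: "v \<in> weyl R"
  shows "m u v = (\<Sum>x\<in>bruhat_interval R u v. bar (r x v))"
proof -
  let ?A = "{x. x \<in> weyl R \<and> bruhat_le R u x}"
  have "m u v = (\<Sum>x\<in>?A. cf (T x * \<mu> v) id)"
    by (simp add: m_fun_def Lambda_coeff psi_def sum_distrib_right T_coeff_sum)
  also have "\<dots> = (\<Sum>x\<in>?A. bar (r x v))"
    by (rule sum.cong) (auto simp: T_coeff_T_mult r_fun_def)
  also have "\<dots> = (\<Sum>x\<in>bruhat_interval R u v. bar (r x v))"
  proof (rule sum.mono_neutral_right)
    show "\<forall>x\<in>?A - bruhat_interval R u v. bar (r x v) = 0"
    proof
      fix x assume "x \<in> ?A - bruhat_interval R u v"
      then have x: "x \<in> weyl R" "\<not> bruhat_le R x v" by (auto simp: bruhat_interval_def)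
      then have "cf (\<mu> v) (inv x) = 0"
        using mu_support[OF v inv_weyl[OF x(1)]] by auto
      then show "bar (r x v) = 0" by (simp add: r_fun_def)
    qed
  qed (auto simp: finite_weyl bruhat_interval_def)
  finally show ?thesis .
qed

lemma eps_interval_sum:
  assumes "u \<in> weyl R" "y \<in> weyl R"
  shows "(\<Sum>x\<in>bruhat_interval R u y. eps R x) = (if u = y then eps R u else 0)"
proof (cases "u = y")
  case True
  then show ?thesis using assms by (simp add: bruhat_interval_same)
next
  case False
  have "(\<Sum>x\<in>bruhat_interval R u y. eps R x) =
      of_int (\<Sum>x\<in>bruhat_interval R u y. (- 1) ^ len R x)"
    by (simp add: eps_def)
  with interval_sum_zero[OF assms False] False show ?thesis by simp
qed

text \<open>Conjugating the first formula and inserting it gives a double sum over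
  \<open>u \<le> x \<le> y \<le> v\<close>. Summing over \<open>x\<close> first leaves the signed
  count of the interval from \<open>u\<close> to \<open>y\<close>, which vanishes unless
  \<open>y = u\<close>.\<close>

lemma r_fun_eq_sum:
  assumes u: "u \<in> weyl R" and v: "v \<in> weyl R" and uv: "bruhat_le R u v"
  shows "r u v = (\<Sum>x\<in>bruhat_interval R u v. eps R u * eps R x * bar (m x v))"
proof -
  let ?I = "bruhat_interval R u v"
  \<comment> \<open>By transitivity both slices of the summation range are again intervals.\<close>
  have I: "{y \<in> ?I. bruhat_le R x y} = bruhat_interval R x v" if "x \<in> ?I" for x
    using that bruhat_trans unfolding bruhat_interval_def by blast
  have J: "{x \<in> ?I. bruhat_le R x y} = bruhat_interval R u y" if "y \<in> ?I" for y
    using that bruhat_trans unfolding bruhat_interval_def by blast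
  have "(\<Sum>x\<in>?I. eps R u * eps R x * bar (m x v)) =
      (\<Sum>x\<in>?I. \<Sum>y | y \<in> ?I \<and> bruhat_le R x y. eps R u * eps R x * r y v)"
    by (rule sum.cong) (simp_all add: I m_fun_eq_sum[OF v] bar_sum sum_distrib_left)
  also have "\<dots> = (\<Sum>y\<in>?I. \<Sum>x | x \<in> ?I \<and> bruhat_le R x y. eps R u * eps R x * r y v)"
    by (rule sum.swap_restrict) (simp_all add: finite_bruhat_interval)
  also have "\<dots> = (\<Sum>y\<in>?I. eps R u * r y v * (\<Sum>x\<in>bruhat_interval R u y. eps R x))"
    by (rule sum.cong) (simp_all add: J sum_distrib_left mult_ac)
  also have "\<dots> = (\<Sum>y\<in>?I. if y = u then r u v else 0)"
  proof (rule sum.cong)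
    fix y assume "y \<in> ?I"
    then have "y \<in> weyl R" by (simp add: bruhat_interval_def)
    moreover have "eps R u * eps R u = 1" by (simp add: eps_def flip: power_mult_distrib)
    ultimately show "eps R u * r y v * (\<Sum>x\<in>bruhat_interval R u y. eps R x) =
        (if y = u then r u v else 0)"
      by (auto simp: eps_interval_sum[OF u] mult_ac)
  qed simp
  also have "\<dots> = r u v"
    using u uv bruhat_refl by (simp add: finite_bruhat_interval) (simp add: bruhat_interval_def)
  finally show ?thesis by simp
qed

end

theorem theorem3:
  fixes R :: "'x::linordered_ab_group_add root_datum"
    and scale :: "'x ratfun \<Rightarrow> 'h::ring_1 \<Rightarrow> 'h"
    and T \<mu> :: "('x \<Rightarrow> 'x) \<Rightarrow> 'h"
    and u v :: "'x \<Rightarrow> 'x"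
  assumes "based_root_datum R"
    and "hecke_algebra scale R T"
    and "mu_family scale R T \<mu>"
    and "u \<in> weyl R" and "v \<in> weyl R" and "bruhat_le R u v"
  shows "m_fun scale R T \<mu> u v = (\<Sum>x\<in>bruhat_interval R u v. bar (r_fun scale R T \<mu> x v)) \<and>
    r_fun scale R T \<mu> u v =
      (\<Sum>x\<in>bruhat_interval R u v. eps R u * eps R x * bar (m_fun scale R T \<mu> x v))"
proof -
  interpret weyl_mu R scale T \<mu>
    using assms(1,3) by (simp add: weyl_mu_def)
  show ?thesis using assms(4-6) m_fun_eq_sum r_fun_eq_sum by blast
qed

end
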